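(* Let $\mathcal C$ be a $k$-linear finite pivotal category over a field $k$. A Calabi–Yau structure on $\mathsf{Proj}(\mathcal C)$ is compatible with duality on the right (respectively left) if and only if the corresponding trace maps are non-degenerate and have the right (respectively left) partial trace property.
   Context: A finite pivotal category is a $k$-linear abelian category $\mathcal C$ that is (1) finite, i.e. equivalent to the category of finite-dimensional left modules over a finite-dimensional $k$-algebra; (2) rigid monoidal with $k$-bilinear bi-exact tensor product; (3) with simple tensor unit $\mathbf 1$; and equipped with a pivotal structure, i.e. a monoidal natural isomorphism $\delta:\mathrm{id}_{\mathcal C}\to(-)^{**}$. Left duality maps are $\mathrm{ev}_V:V^*\otimes V\to\mathbf 1$, $\mathrm{coev}_V:\mathbf 1\to V\otimes V^*$; right duality maps are $\widetilde{\mathrm{ev}}_V=\mathrm{ev}_{V^*}\circ(\delta_V\otimes\mathrm{id}_{V^*}):V\otimes V^*\to\mathbf 1$ and $\widetilde{\mathrm{coev}}_V=(\mathrm{id}_{V^*}\otimes\delta_V^{-1})\circ\mathrm{coev}_{V^*}:\mathbf 1\to V^*\otimes V$. $\mathsf{Proj}(\mathcal C)$ is the full subcategory (tensor ideal) of projective objects. For $f\in\operatorname{End}_{\mathcal C}(W\otimes V)$: $\operatorname{tr}^l_W(f)=(\mathrm{ev}_W\otimes\mathrm{id}_V)(\mathrm{id}_{W^*}\otimes f)(\widetilde{\mathrm{coev}}_W\otimes\mathrm{id}_V)$ and $\operatorname{tr}^r_V(f)=(\mathrm{id}_W\otimes\widetilde{\mathrm{ev}}_V)(f\otimes\mathrm{id}_{V^*})(\mathrm{id}_W\otimes\mathrm{coev}_V)$.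 A Calabi–Yau structure on a $k$-linear category $\mathcal D$ is a family of linear maps (trace maps) $\{t_V:\operatorname{End}_{\mathcal D}(V)\to k\}_{V\in\mathcal D}$ with $t_V(b\circ a)=t_W(a\circ b)$ for all $a:V\to W$, $b:W\to V$, such that $\operatorname{Hom}_{\mathcal D}(V,W)\times\operatorname{Hom}_{\mathcal D}(W,V)\to k$, $(a,b)\mapsto t_W(a\circ b)$ is non-degenerate for all $V,W\in\mathcal D$. A Calabi–Yau structure on $\mathcal D=\mathsf{Proj}(\mathcal C)$ is compatible with duality on the right if $t_{U\otimes V}(b\circ a)=t_U\bigl(d^{\cap}(b)\circ d_{\cup}(a)\bigr)$ for all $U,V,W\in\mathcal D$, $a:U\otimes V\to W$, $b:W\to U\otimes V$, where $d_\cup(a)=(a\otimes\mathrm{id}_{V^*})(\mathrm{id}_U\otimes\mathrm{coev}_V):U\to W\otimes V^*$ and $d^\cap(b)=(\mathrm{id}_U\otimes\widetilde{\mathrm{ev}}_V)(b\otimes\mathrm{id}_{V^*}):W\otimes V^*\to U$. It is compatible with duality on the left if $t_{U\otimes V}(b\circ a)=t_V\bigl({}^{\cap}d(b)\circ{}_{\cup}d(a)\bigr)$ for all such $a,b$, where ${}_\cup d(a)=(\mathrm{id}_{U^*}\otimes a)(\widetilde{\mathrm{coev}}_U\otimes\mathrm{id}_V):V\to U^*\otimes W$ and ${}^\cap d(b)=(\mathrm{ev}_U\otimes\mathrm{id}_V)(\mathrm{id}_{U^*}\otimes b):U^*\otimes W\to V$. The family $\{t_P\}_{P\in\mathsf{Proj}(\mathcal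 C)}$ is non-degenerate if for all $P\in\mathsf{Proj}(\mathcal C)$ and all $M\in\mathcal C$ the pairing $\operatorname{Hom}_{\mathcal C}(M,P)\times\operatorname{Hom}_{\mathcal C}(P,M)\to k$, $(a,b)\mapsto t_P(a\circ b)$ is non-degenerate. It has the right partial trace property if $t_{P\otimes V}(f)=t_P(\operatorname{tr}^r_V(f))$ for all $P\in\mathsf{Proj}(\mathcal C)$, $V\in\mathcal C$, $f\in\operatorname{End}_{\mathcal C}(P\otimes V)$, and the left partial trace property if $t_{V\otimes P}(f)=t_P(\operatorname{tr}^l_V(f))$ for all $f\in\operatorname{End}_{\mathcal C}(V\otimes P)$. *)

theory Defs
  imports "HOL-Algebra.Module"
begin

section \<open>Linear categories\<close>

text \<open>
  The hom spaces are modules in the sense of HOL-Algebra; the ring multiplication and unit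
  fields which the record type inherits carry no meaning here. An arrow determines its source
  and target (axiom \<open>hom_disjoint\<close> below), so operations on arrows take no object arguments.
\<close>

record ('k, 'o, 'm) lin_cat =
  Obj :: "'o set"
  Hom :: "'o \<Rightarrow> 'o \<Rightarrow> ('k, 'm) module"
  Comp :: "'m \<Rightarrow> 'm \<Rightarrow> 'm" (infixr "\<cdot>\<index>" 65)
  Ident :: "'o \<Rightarrow> 'm" ("\<i>\<d>\<index>")

abbreviation Arr :: "('k, 'o, 'm, 'z) lin_cat_scheme \<Rightarrow> 'o \<Rightarrow> 'o \<Rightarrow> 'm set" where
  "Arr C X Y \<equiv> carrier (Hom C X Y)"

locale linear_category =
  fixes K :: "('k, 'r) ring_scheme"
    and C :: "('k, 'o, 'm, 'z) lin_cat_scheme" (structure)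
  assumes field: "field K"
    and hom_space: "\<lbrakk>X \<in> Obj C; Y \<in> Obj C\<rbrakk> \<Longrightarrow> module K (Hom C X Y)"
    and hom_disjoint:
      "\<lbrakk>X \<in> Obj C; Y \<in> Obj C; X' \<in> Obj C; Y' \<in> Obj C; f \<in> Arr C X Y; f \<in> Arr C X' Y'\<rbrakk>
        \<Longrightarrow> X = X' \<and> Y = Y'"
    and comp_closed:
      "\<lbrakk>X \<in> Obj C; Y \<in> Obj C; Z \<in> Obj C; g \<in> Arr C Y Z; f \<in> Arr C X Y\<rbrakk>
        \<Longrightarrow> g \<cdot> f \<in> Arr C X Z"
    and comp_assoc:
      "\<lbrakk>W \<in> Obj C; X \<in> Obj C; Y \<in> Obj C; Z \<in> Obj C;
        h \<in> Arr C Y Z; g \<in> Arr C X Y; f \<in> Arr C W X\<rbrakk> \<Longrightarrow> (h \<cdot> g) \<cdot> f = h \<cdot> (g \<cdot> f)"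
    and ident_closed: "X \<in> Obj C \<Longrightarrow> \<i>\<d> X \<in> Arr C X X"
    and comp_ident_right: "\<lbrakk>X \<in> Obj C; Y \<in> Obj C; f \<in> Arr C X Y\<rbrakk> \<Longrightarrow> f \<cdot> \<i>\<d> X = f"
    and comp_ident_left: "\<lbrakk>X \<in> Obj C; Y \<in> Obj C; f \<in> Arr C X Y\<rbrakk> \<Longrightarrow> \<i>\<d> Y \<cdot> f = f"
    and comp_add_left:
      "\<lbrakk>X \<in> Obj C; Y \<in> Obj C; Z \<in> Obj C; g \<in> Arr C Y Z; g' \<in> Arr C Y Z; f \<in> Arr C X Y\<rbrakk>
        \<Longrightarrow> (g \<oplus>\<^bsub>Hom C Y Z\<^esub> g') \<cdot> f = (g \<cdot> f) \<oplus>\<^bsub>Hom C X Z\<^esub> (g' \<cdot> f)"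
    and comp_add_right:
      "\<lbrakk>X \<in> Obj C; Y \<in> Obj C; Z \<in> Obj C; g \<in> Arr C Y Z; f \<in> Arr C X Y; f' \<in> Arr C X Y\<rbrakk>
        \<Longrightarrow> g \<cdot> (f \<oplus>\<^bsub>Hom C X Y\<^esub> f') = (g \<cdot> f) \<oplus>\<^bsub>Hom C X Z\<^esub> (g \<cdot> f')"
    and comp_smult_left:
      "\<lbrakk>X \<in> Obj C; Y \<in> Obj C; Z \<in> Obj C; c \<in> carrier K; g \<in> Arr C Y Z; f \<in> Arr C X Y\<rbrakk>
        \<Longrightarrow> (c \<odot>\<^bsub>Hom C Y Z\<^esub> g) \<cdot> f = c \<odot>\<^bsub>Hom C X Z\<^esub> (g \<cdot> f)"
    and comp_smult_right:
      "\<lbrakk>X \<in> Obj C; Y \<in> Obj C; Z \<in> Obj C; c \<in> carrier K; g \<in> Arr C Y Z; f \<in> Arr C X Y\<rbrakk>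
        \<Longrightarrow> g \<cdot> (c \<odot>\<^bsub>Hom C X Y\<^esub> f) = c \<odot>\<^bsub>Hom C X Z\<^esub> (g \<cdot> f)"

context
  fixes C :: "('k, 'o, 'm, 'z) lin_cat_scheme" (structure)
begin

definition inverse_arrows :: "'o \<Rightarrow> 'o \<Rightarrow> 'm \<Rightarrow> 'm \<Rightarrow> bool" where
  "inverse_arrows X Y f g \<longleftrightarrow>
     f \<in> Arr C X Y \<and> g \<in> Arr C Y X \<and> g \<cdot> f = \<i>\<d> X \<and> f \<cdot> g = \<i>\<d> Y"

definition iso_arrow :: "'o \<Rightarrow> 'o \<Rightarrow> 'm \<Rightarrow> bool" where
  "iso_arrow X Y f \<longleftrightarrow> (\<exists>g. inverse_arrows X Y f g)"

definition inv_arrow :: "'m \<Rightarrow> 'm" where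
  "inv_arrow f = (THE g. \<exists>X\<in>Obj C. \<exists>Y\<in>Obj C. inverse_arrows X Y f g)"

definition monic :: "'o \<Rightarrow> 'o \<Rightarrow> 'm \<Rightarrow> bool" where
  "monic X Y f \<longleftrightarrow> f \<in> Arr C X Y \<and>
     (\<forall>W\<in>Obj C. \<forall>g\<in>Arr C W X. \<forall>h\<in>Arr C W X. f \<cdot> g = f \<cdot> h \<longrightarrow> g = h)"

definition epic :: "'o \<Rightarrow> 'o \<Rightarrow> 'm \<Rightarrow> bool" where
  "epic X Y f \<longleftrightarrow> f \<in> Arr C X Y \<and>
     (\<forall>Z\<in>Obj C. \<forall>g\<in>Arr C Y Z. \<forall>h\<in>Arr C Y Z. g \<cdot> f = h \<cdot> f \<longrightarrow> g = h)"

definition zero_object :: "'o \<Rightarrow> bool" where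
  "zero_object Z \<longleftrightarrow> Z \<in> Obj C \<and>
     (\<forall>X\<in>Obj C. (\<exists>!f. f \<in> Arr C X Z) \<and> (\<exists>!f. f \<in> Arr C Z X))"

definition is_biproduct :: "'o \<Rightarrow> 'o \<Rightarrow> 'o \<Rightarrow> 'm \<Rightarrow> 'm \<Rightarrow> 'm \<Rightarrow> 'm \<Rightarrow> bool" where
  "is_biproduct X Y S i j p q \<longleftrightarrow> S \<in> Obj C \<and>
     i \<in> Arr C X S \<and> j \<in> Arr C Y S \<and> p \<in> Arr C S X \<and> q \<in> Arr C S Y \<and>
     p \<cdot> i = \<i>\<d> X \<and> q \<cdot> j = \<i>\<d> Y \<and>
     p \<cdot> j = \<zero>\<^bsub>Hom C Y X\<^esub> \<and> q \<cdot> i = \<zero>\<^bsub>Hom C X Y\<^esub> \<and>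
     (i \<cdot> p) \<oplus>\<^bsub>Hom C S S\<^esub> (j \<cdot> q) = \<i>\<d> S"

text \<open>\<open>k : N \<rightarrow> X\<close> is a kernel, resp. \<open>q : Y \<rightarrow> Q\<close> is a cokernel, of \<open>f : X \<rightarrow> Y\<close>.\<close>

definition is_kernel :: "'o \<Rightarrow> 'o \<Rightarrow> 'm \<Rightarrow> 'o \<Rightarrow> 'm \<Rightarrow> bool" where
  "is_kernel X Y f N k \<longleftrightarrow> f \<in> Arr C X Y \<and> k \<in> Arr C N X \<and> f \<cdot> k = \<zero>\<^bsub>Hom C N Y\<^esub> \<and>
     (\<forall>W\<in>Obj C. \<forall>g\<in>Arr C W X. f \<cdot> g = \<zero>\<^bsub>Hom C W Y\<^esub> \<longrightarrow>
        (\<exists>!h. h \<in> Arr C W N \<and> k \<cdot> h = g))"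

definition is_cokernel :: "'o \<Rightarrow> 'o \<Rightarrow> 'm \<Rightarrow> 'o \<Rightarrow> 'm \<Rightarrow> bool" where
  "is_cokernel X Y f Q q \<longleftrightarrow> f \<in> Arr C X Y \<and> q \<in> Arr C Y Q \<and> q \<cdot> f = \<zero>\<^bsub>Hom C X Q\<^esub> \<and>
     (\<forall>W\<in>Obj C. \<forall>g\<in>Arr C Y W. g \<cdot> f = \<zero>\<^bsub>Hom C X W\<^esub> \<longrightarrow>
        (\<exists>!h. h \<in> Arr C Q W \<and> h \<cdot> q = g))"

definition short_exact :: "'o \<Rightarrow> 'o \<Rightarrow> 'o \<Rightarrow> 'm \<Rightarrow> 'm \<Rightarrow> bool" where
  "short_exact X Y Z f g \<longleftrightarrow> is_kernel Y Z g X f \<and> is_cokernel X Y f Z g"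

definition simple_object :: "'o \<Rightarrow> bool" where
  "simple_object S \<longleftrightarrow> S \<in> Obj C \<and> \<not> zero_object S \<and>
     (\<forall>X\<in>Obj C. \<forall>f. monic X S f \<longrightarrow> zero_object X \<or> iso_arrow X S f)"

definition projective_object :: "'o \<Rightarrow> bool" where
  "projective_object P \<longleftrightarrow> P \<in> Obj C \<and>
     (\<forall>X\<in>Obj C. \<forall>Y\<in>Obj C. \<forall>e f. epic X Y e \<and> f \<in> Arr C P Y \<longrightarrow>
        (\<exists>g\<in>Arr C P X. e \<cdot> g = f))"

end

locale abelian_category = linear_category +
  assumes has_zero_object: "\<exists>Z. zero_object C Z"
    and has_biproducts:
      "\<lbrakk>X \<in> Obj C; Y \<in> Obj C\<rbrakk> \<Longrightarrow> \<exists>S i j p q. is_biproduct C X Y S i j p q"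
    and has_kernels:
      "\<lbrakk>X \<in> Obj C; Y \<in> Obj C; f \<in> Arr C X Y\<rbrakk> \<Longrightarrow> \<exists>N\<in>Obj C. \<exists>k. is_kernel C X Y f N k"
    and has_cokernels:
      "\<lbrakk>X \<in> Obj C; Y \<in> Obj C; f \<in> Arr C X Y\<rbrakk> \<Longrightarrow> \<exists>Q\<in>Obj C. \<exists>q. is_cokernel C X Y f Q q"
    and monic_normal:
      "\<lbrakk>X \<in> Obj C; Y \<in> Obj C; monic C X Y f\<rbrakk> \<Longrightarrow> \<exists>Z\<in>Obj C. \<exists>g. is_kernel C Y Z g X f"
    and epic_normal:
      "\<lbrakk>X \<in> Obj C; Y \<in> Obj C; epic C X Y f\<rbrakk> \<Longrightarrow> \<exists>W\<in>Obj C. \<exists>g. is_cokernel C W X g Y f"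

definition Proj :: "('k, 'o, 'm, 'z) lin_cat_scheme \<Rightarrow> ('k, 'o, 'm, 'z) lin_cat_scheme" where
  "Proj C = C\<lparr>Obj := {P \<in> Obj C. projective_object C P}\<rparr>"


section \<open>Finite linear categories\<close>

locale linear_functor =
  source: linear_category K C + target: linear_category K D
  for K :: "('k, 'r) ring_scheme"
    and C :: "('k, 'o, 'm, 'z) lin_cat_scheme"
    and D :: "('k, 'p, 'n, 'y) lin_cat_scheme" +
  fixes Fo :: "'o \<Rightarrow> 'p" and Fm :: "'m \<Rightarrow> 'n"
  assumes obj_closed: "X \<in> Obj C \<Longrightarrow> Fo X \<in> Obj D"
    and arr_closed:
      "\<lbrakk>X \<in> Obj C; Y \<in> Obj C; f \<in> Arr C X Y\<rbrakk> \<Longrightarrow> Fm f \<in> Arr D (Fo X) (Fo Y)"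
    and map_ident: "X \<in> Obj C \<Longrightarrow> Fm (\<i>\<d>\<^bsub>C\<^esub> X) = \<i>\<d>\<^bsub>D\<^esub> (Fo X)"
    and map_comp:
      "\<lbrakk>X \<in> Obj C; Y \<in> Obj C; Z \<in> Obj C; g \<in> Arr C Y Z; f \<in> Arr C X Y\<rbrakk>
        \<Longrightarrow> Fm (g \<cdot>\<^bsub>C\<^esub> f) = Fm g \<cdot>\<^bsub>D\<^esub> Fm f"
    and map_add:
      "\<lbrakk>X \<in> Obj C; Y \<in> Obj C; f \<in> Arr C X Y; g \<in> Arr C X Y\<rbrakk>
        \<Longrightarrow> Fm (f \<oplus>\<^bsub>Hom C X Y\<^esub> g) = Fm f \<oplus>\<^bsub>Hom D (Fo X) (Fo Y)\<^esub> Fm g"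
    and map_smult:
      "\<lbrakk>X \<in> Obj C; Y \<in> Obj C; c \<in> carrier K; f \<in> Arr C X Y\<rbrakk>
        \<Longrightarrow> Fm (c \<odot>\<^bsub>Hom C X Y\<^esub> f) = c \<odot>\<^bsub>Hom D (Fo X) (Fo Y)\<^esub> Fm f"

definition natural_iso ::
  "('k, 'o, 'm, 'z) lin_cat_scheme \<Rightarrow> ('l, 'p, 'n, 'y) lin_cat_scheme \<Rightarrow>
   ('o \<Rightarrow> 'p) \<Rightarrow> ('m \<Rightarrow> 'n) \<Rightarrow> ('o \<Rightarrow> 'p) \<Rightarrow> ('m \<Rightarrow> 'n) \<Rightarrow> ('o \<Rightarrow> 'n) \<Rightarrow> bool" where
  "natural_iso C D Fo Fm Go Gm \<eta> \<longleftrightarrow>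
     (\<forall>X\<in>Obj C. iso_arrow D (Fo X) (Go X) (\<eta> X)) \<and>
     (\<forall>X\<in>Obj C. \<forall>Y\<in>Obj C. \<forall>f\<in>Arr C X Y. \<eta> Y \<cdot>\<^bsub>D\<^esub> Fm f = Gm f \<cdot>\<^bsub>D\<^esub> \<eta> X)"

definition linearly_equivalent ::
  "('k, 'r) ring_scheme \<Rightarrow> ('k, 'o, 'm, 'z) lin_cat_scheme \<Rightarrow>
   ('k, 'p, 'n, 'y) lin_cat_scheme \<Rightarrow> bool" where
  "linearly_equivalent K C D \<longleftrightarrow>
     (\<exists>Fo Fm Go Gm \<eta> \<epsilon>. linear_functor K C D Fo Fm \<and> linear_functor K D C Go Gm \<and>
        natural_iso C C (\<lambda>X. X) (\<lambda>f. f) (\<lambda>X. Go (Fo X)) (\<lambda>f. Gm (Fm f)) \<eta> \<and>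
        natural_iso D D (\<lambda>X. Fo (Go X)) (\<lambda>f. Fm (Gm f)) (\<lambda>X. X) (\<lambda>f. f) \<epsilon>)"

definition finite_dim :: "('k, 'r) ring_scheme \<Rightarrow> ('k, 'v, 's) module_scheme \<Rightarrow> bool" where
  "finite_dim K V \<longleftrightarrow>
     (\<exists>B. finite B \<and> B \<subseteq> carrier V \<and>
        (\<forall>v\<in>carrier V. \<exists>c\<in>B \<rightarrow> carrier K. v = (\<Oplus>\<^bsub>V\<^esub>b\<in>B. c b \<odot>\<^bsub>V\<^esub> b)))"

text \<open>The locale \<open>algebra\<close> of HOL-Algebra is restricted to commutative algebras.\<close>

locale fin_dim_algebra =
  ring A + module K A
  for K :: "('k, 'r) ring_scheme" and A :: "('k, 'a, 's) module_scheme" +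
  assumes base_field: "field K"
    and smult_mult_left: "\<lbrakk>c \<in> carrier K; x \<in> carrier A; y \<in> carrier A\<rbrakk>
        \<Longrightarrow> (c \<odot>\<^bsub>A\<^esub> x) \<otimes>\<^bsub>A\<^esub> y = c \<odot>\<^bsub>A\<^esub> (x \<otimes>\<^bsub>A\<^esub> y)"
    and smult_mult_right: "\<lbrakk>c \<in> carrier K; x \<in> carrier A; y \<in> carrier A\<rbrakk>
        \<Longrightarrow> x \<otimes>\<^bsub>A\<^esub> (c \<odot>\<^bsub>A\<^esub> y) = c \<odot>\<^bsub>A\<^esub> (x \<otimes>\<^bsub>A\<^esub> y)"
    and finite_dimensional: "finite_dim K A"

text \<open>The locale \<open>module\<close> of HOL-Algebra is restricted to commutative rings of scalars.\<close>

locale left_module =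
  ring A + abelian_group M
  for A :: "('a, 'r) ring_scheme" and M :: "('a, 'v, 's) module_scheme" +
  assumes act_closed: "\<lbrakk>a \<in> carrier A; x \<in> carrier M\<rbrakk> \<Longrightarrow> a \<odot>\<^bsub>M\<^esub> x \<in> carrier M"
    and act_add_scalar: "\<lbrakk>a \<in> carrier A; b \<in> carrier A; x \<in> carrier M\<rbrakk>
        \<Longrightarrow> (a \<oplus>\<^bsub>A\<^esub> b) \<odot>\<^bsub>M\<^esub> x = (a \<odot>\<^bsub>M\<^esub> x) \<oplus>\<^bsub>M\<^esub> (b \<odot>\<^bsub>M\<^esub> x)"
    and act_add_vector: "\<lbrakk>a \<in> carrier A; x \<in> carrier M; y \<in> carrier M\<rbrakk>
        \<Longrightarrow> a \<odot>\<^bsub>M\<^esub> (x \<oplus>\<^bsub>M\<^esub> y) = (a \<odot>\<^bsub>M\<^esub> x) \<oplus>\<^bsub>M\<^esub> (a \<odot>\<^bsub>M\<^esub> y)"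
    and act_mult: "\<lbrakk>a \<in> carrier A; b \<in> carrier A; x \<in> carrier M\<rbrakk>
        \<Longrightarrow> (a \<otimes>\<^bsub>A\<^esub> b) \<odot>\<^bsub>M\<^esub> x = a \<odot>\<^bsub>M\<^esub> (b \<odot>\<^bsub>M\<^esub> x)"
    and act_one: "x \<in> carrier M \<Longrightarrow> \<one>\<^bsub>A\<^esub> \<odot>\<^bsub>M\<^esub> x = x"

text \<open>The vector space underlying a left module over a \<open>K\<close>-algebra \<open>A\<close>.\<close>

definition underlying_space ::
  "('k, 'a, 's) module_scheme \<Rightarrow> ('a, 'v, 'u) module_scheme \<Rightarrow> ('k, 'v) module" where
  "underlying_space A M =
     \<lparr>carrier = carrier M, mult = mult M, one = one M, zero = zero M, add = add M,
      smult = (\<lambda>c x. (c \<odot>\<^bsub>A\<^esub> \<one>\<^bsub>A\<^esub>) \<odot>\<^bsub>M\<^esub> x)\<rparr>"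

definition module_maps ::
  "('a, 'r) ring_scheme \<Rightarrow> ('a, 'v, 's) module_scheme \<Rightarrow> ('a, 'w, 'u) module_scheme \<Rightarrow>
   ('v \<Rightarrow> 'w) set" where
  "module_maps A M N =
     {f \<in> carrier M \<rightarrow>\<^sub>E carrier N.
        (\<forall>x\<in>carrier M. \<forall>y\<in>carrier M. f (x \<oplus>\<^bsub>M\<^esub> y) = f x \<oplus>\<^bsub>N\<^esub> f y) \<and>
        (\<forall>a\<in>carrier A. \<forall>x\<in>carrier M. f (a \<odot>\<^bsub>M\<^esub> x) = a \<odot>\<^bsub>N\<^esub> f x)}"

text \<open>
  Finite-dimensional left \<open>A\<close>-modules whose elements are taken from a type \<open>'v\<close>. An arrow
  \<open>M \<rightarrow> N\<close> is a triple \<open>(M, N, f)\<close>.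
\<close>

definition module_category ::
  "('k, 'r) ring_scheme \<Rightarrow> ('k, 'a) module \<Rightarrow>
   ('k, ('a, 'v) module, ('a, 'v) module \<times> ('a, 'v) module \<times> ('v \<Rightarrow> 'v)) lin_cat" where
  "module_category K A =
     \<lparr>Obj = {M. left_module A M \<and> finite_dim K (underlying_space A M)},
      Hom = (\<lambda>M N.
        \<lparr>carrier = {(M, N, f) |f. f \<in> module_maps A M N},
         mult = undefined, one = undefined,
         zero = (M, N, \<lambda>x\<in>carrier M. \<zero>\<^bsub>N\<^esub>),
         add = (\<lambda>(_, _, f) (_, _, g). (M, N, \<lambda>x\<in>carrier M. f x \<oplus>\<^bsub>N\<^esub> g x)),
         smult = (\<lambda>c (_, _, f). (M, N, \<lambda>x\<in>carrier M. c \<odot>\<^bsub>underlying_space A N\<^esub> f x))\<rparr>),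
      Comp = (\<lambda>(_, P, g) (M, _, f). (M, P, compose (carrier M) g f)),
      Ident = (\<lambda>M. (M, M, \<lambda>x\<in>carrier M. x))\<rparr>"

text \<open>
  Every finite-dimensional vector space over \<open>K\<close> is isomorphic to one whose elements are
  coordinate functions of type \<open>nat \<Rightarrow> 'k\<close>. Hence, up to isomorphism resp. equivalence, this
  type is large enough for all finite-dimensional algebras and all their finite-dimensional
  modules.
\<close>

definition finite_category ::
  "('k, 'r) ring_scheme \<Rightarrow> ('k, 'o, 'm, 'z) lin_cat_scheme \<Rightarrow> bool" where
  "finite_category K C \<longleftrightarrow>
     (\<exists>A :: ('k, nat \<Rightarrow> 'k) module. fin_dim_algebra K A \<and>
        linearly_equivalent K C
          (module_category K A ::
            ('k, (nat \<Rightarrow> 'k, nat \<Rightarrow> 'k) module,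
             (nat \<Rightarrow> 'k, nat \<Rightarrow> 'k) module \<times> (nat \<Rightarrow> 'k, nat \<Rightarrow> 'k) module \<times>
             ((nat \<Rightarrow> 'k) \<Rightarrow> (nat \<Rightarrow> 'k))) lin_cat))"


section \<open>Finite pivotal categories\<close>

text \<open>
  Monoidal categories are not assumed strict: \<open>\<a>\<close>, \<open>\<l>\<close> and \<open>\<r>\<close> are the associator
  \<open>(X \<boxtimes> Y) \<boxtimes> Z \<rightarrow> X \<boxtimes> (Y \<boxtimes> Z)\<close> and the unitors \<open>\<I> \<boxtimes> X \<rightarrow> X\<close> and \<open>X \<boxtimes> \<I> \<rightarrow> X\<close>.
  The tensor product is written \<open>\<boxtimes>\<close> on objects and \<open>\<star>\<close> on arrows.
\<close>

record ('k, 'o, 'm) monoidal_cat = "('k, 'o, 'm) lin_cat" +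
  TenObj :: "'o \<Rightarrow> 'o \<Rightarrow> 'o" (infixl "\<boxtimes>\<index>" 75)
  TenArr :: "'m \<Rightarrow> 'm \<Rightarrow> 'm" (infixl "\<star>\<index>" 75)
  UnitObj :: "'o" ("\<I>\<index>")
  Assoc :: "'o \<Rightarrow> 'o \<Rightarrow> 'o \<Rightarrow> 'm" ("\<a>\<index>")
  LUnit :: "'o \<Rightarrow> 'm" ("\<l>\<index>")
  RUnit :: "'o \<Rightarrow> 'm" ("\<r>\<index>")

text \<open>
  A left dual \<open>Dual X\<close>, written \<open>X\<^sup>\<or>\<close>, of each object \<open>X\<close> with \<open>ev X : Dual X \<boxtimes> X \<rightarrow> \<I>\<close> and
  \<open>coev X : \<I> \<rightarrow> X \<boxtimes> Dual X\<close>, and the components \<open>\<delta> X : X \<rightarrow> Dual (Dual X)\<close> of a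
  pivotal structure.
\<close>

record ('k, 'o, 'm) pivotal_cat = "('k, 'o, 'm) monoidal_cat" +
  Dual :: "'o \<Rightarrow> 'o" ("_\<^sup>\<or>\<index>" [999] 999)
  Ev :: "'o \<Rightarrow> 'm" ("ev\<index>")
  Coev :: "'o \<Rightarrow> 'm" ("coev\<index>")
  Piv :: "'o \<Rightarrow> 'm" ("\<delta>\<index>")

locale monoidal_linear_category = linear_category K C
  for K :: "('k, 'r) ring_scheme"
    and C :: "('k, 'o, 'm, 'z) monoidal_cat_scheme" (structure) +
  assumes unit_closed: "\<I> \<in> Obj C"
    and ten_obj_closed: "\<lbrakk>X \<in> Obj C; Y \<in> Obj C\<rbrakk> \<Longrightarrow> X \<boxtimes> Y \<in> Obj C"
    and ten_closed:
      "\<lbrakk>X \<in> Obj C; Y \<in> Obj C; X' \<in> Obj C; Y' \<in> Obj C; f \<in> Arr C X Y; g \<in> Arr C X' Y'\<rbrakk>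
        \<Longrightarrow> f \<star> g \<in> Arr C (X \<boxtimes> X') (Y \<boxtimes> Y')"
    and ten_ident: "\<lbrakk>X \<in> Obj C; Y \<in> Obj C\<rbrakk> \<Longrightarrow> \<i>\<d> X \<star> \<i>\<d> Y = \<i>\<d> (X \<boxtimes> Y)"
    and ten_comp:
      "\<lbrakk>X \<in> Obj C; Y \<in> Obj C; Z \<in> Obj C; X' \<in> Obj C; Y' \<in> Obj C; Z' \<in> Obj C;
        f \<in> Arr C X Y; g \<in> Arr C Y Z; f' \<in> Arr C X' Y'; g' \<in> Arr C Y' Z'\<rbrakk>
        \<Longrightarrow> (g \<cdot> f) \<star> (g' \<cdot> f') = (g \<star> g') \<cdot> (f \<star> f')"
    and ten_add_left:
      "\<lbrakk>X \<in> Obj C; Y \<in> Obj C; X' \<in> Obj C; Y' \<in> Obj C;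
        f \<in> Arr C X Y; f' \<in> Arr C X Y; g \<in> Arr C X' Y'\<rbrakk>
        \<Longrightarrow> (f \<oplus>\<^bsub>Hom C X Y\<^esub> f') \<star> g
            = (f \<star> g) \<oplus>\<^bsub>Hom C (X \<boxtimes> X') (Y \<boxtimes> Y')\<^esub> (f' \<star> g)"
    and ten_add_right:
      "\<lbrakk>X \<in> Obj C; Y \<in> Obj C; X' \<in> Obj C; Y' \<in> Obj C;
        f \<in> Arr C X Y; g \<in> Arr C X' Y'; g' \<in> Arr C X' Y'\<rbrakk>
        \<Longrightarrow> f \<star> (g \<oplus>\<^bsub>Hom C X' Y'\<^esub> g')
            = (f \<star> g) \<oplus>\<^bsub>Hom C (X \<boxtimes> X') (Y \<boxtimes> Y')\<^esub> (f \<star> g')"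
    and ten_smult_left:
      "\<lbrakk>X \<in> Obj C; Y \<in> Obj C; X' \<in> Obj C; Y' \<in> Obj C;
        c \<in> carrier K; f \<in> Arr C X Y; g \<in> Arr C X' Y'\<rbrakk>
        \<Longrightarrow> (c \<odot>\<^bsub>Hom C X Y\<^esub> f) \<star> g = c \<odot>\<^bsub>Hom C (X \<boxtimes> X') (Y \<boxtimes> Y')\<^esub> (f \<star> g)"
    and ten_smult_right:
      "\<lbrakk>X \<in> Obj C; Y \<in> Obj C; X' \<in> Obj C; Y' \<in> Obj C;
        c \<in> carrier K; f \<in> Arr C X Y; g \<in> Arr C X' Y'\<rbrakk>
        \<Longrightarrow> f \<star> (c \<odot>\<^bsub>Hom C X' Y'\<^esub> g) = c \<odot>\<^bsub>Hom C (X \<boxtimes> X') (Y \<boxtimes> Y')\<^esub> (f \<star> g)"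
    and assoc_iso:
      "\<lbrakk>X \<in> Obj C; Y \<in> Obj C; Z \<in> Obj C\<rbrakk>
        \<Longrightarrow> iso_arrow C ((X \<boxtimes> Y) \<boxtimes> Z) (X \<boxtimes> (Y \<boxtimes> Z)) (\<a> X Y Z)"
    and assoc_natural:
      "\<lbrakk>X \<in> Obj C; Y \<in> Obj C; Z \<in> Obj C; X' \<in> Obj C; Y' \<in> Obj C; Z' \<in> Obj C;
        f \<in> Arr C X X'; g \<in> Arr C Y Y'; h \<in> Arr C Z Z'\<rbrakk>
        \<Longrightarrow> \<a> X' Y' Z' \<cdot> ((f \<star> g) \<star> h) = (f \<star> (g \<star> h)) \<cdot> \<a> X Y Z"
    and lunit_iso: "X \<in> Obj C \<Longrightarrow> iso_arrow C (\<I> \<boxtimes> X) X (\<l> X)"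
    and lunit_natural:
      "\<lbrakk>X \<in> Obj C; Y \<in> Obj C; f \<in> Arr C X Y\<rbrakk> \<Longrightarrow> \<l> Y \<cdot> (\<i>\<d> \<I> \<star> f) = f \<cdot> \<l> X"
    and runit_iso: "X \<in> Obj C \<Longrightarrow> iso_arrow C (X \<boxtimes> \<I>) X (\<r> X)"
    and runit_natural:
      "\<lbrakk>X \<in> Obj C; Y \<in> Obj C; f \<in> Arr C X Y\<rbrakk> \<Longrightarrow> \<r> Y \<cdot> (f \<star> \<i>\<d> \<I>) = f \<cdot> \<r> X"
    and pentagon:
      "\<lbrakk>W \<in> Obj C; X \<in> Obj C; Y \<in> Obj C; Z \<in> Obj C\<rbrakk>
        \<Longrightarrow> \<a> W X (Y \<boxtimes> Z) \<cdot> \<a> (W \<boxtimes> X) Y Z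
            = (\<i>\<d> W \<star> \<a> X Y Z) \<cdot> \<a> W (X \<boxtimes> Y) Z \<cdot> (\<a> W X Y \<star> \<i>\<d> Z)"
    and triangle:
      "\<lbrakk>X \<in> Obj C; Y \<in> Obj C\<rbrakk> \<Longrightarrow> (\<i>\<d> X \<star> \<l> Y) \<cdot> \<a> X \<I> Y = \<r> X \<star> \<i>\<d> Y"

context
  fixes C :: "('k, 'o, 'm, 'z) monoidal_cat_scheme" (structure)
begin

text \<open>\<open>Y\<close> is a left dual of \<open>X\<close>, equivalently \<open>X\<close> is a right dual of \<open>Y\<close>.\<close>

definition is_left_dual :: "'o \<Rightarrow> 'o \<Rightarrow> 'm \<Rightarrow> 'm \<Rightarrow> bool" where
  "is_left_dual X Y e c \<longleftrightarrow>
     e \<in> Arr C (Y \<boxtimes> X) \<I> \<and> c \<in> Arr C \<I> (X \<boxtimes> Y) \<and>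
     \<r> X \<cdot> (\<i>\<d> X \<star> e) \<cdot> \<a> X Y X \<cdot> (c \<star> \<i>\<d> X) \<cdot> inv_arrow C (\<l> X) = \<i>\<d> X \<and>
     \<l> Y \<cdot> (e \<star> \<i>\<d> Y) \<cdot> inv_arrow C (\<a> Y X Y) \<cdot> (\<i>\<d> Y \<star> c) \<cdot> inv_arrow C (\<r> Y) = \<i>\<d> Y"

end

context
  fixes C :: "('k, 'o, 'm, 'z) pivotal_cat_scheme" (structure)
begin

text \<open>The arrow \<open>Y \<rightarrow> X\<^sup>\<or>\<close> corresponding to \<open>f : Y \<boxtimes> X \<rightarrow> \<I>\<close> under duality.\<close>

definition mate :: "'o \<Rightarrow> 'o \<Rightarrow> 'm \<Rightarrow> 'm" where
  "mate Y X f =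
     \<l> (X\<^sup>\<or>) \<cdot> (f \<star> \<i>\<d> (X\<^sup>\<or>)) \<cdot> inv_arrow C (\<a> Y X (X\<^sup>\<or>)) \<cdot> (\<i>\<d> Y \<star> coev X) \<cdot> inv_arrow C (\<r> Y)"

text \<open>The action \<open>f\<^sup>\<or> : Y\<^sup>\<or> \<rightarrow> X\<^sup>\<or>\<close> of the duality functor on \<open>f : X \<rightarrow> Y\<close>.\<close>

definition dual_arrow :: "'o \<Rightarrow> 'o \<Rightarrow> 'm \<Rightarrow> 'm" where
  "dual_arrow X Y f = mate (Y\<^sup>\<or>) X (ev Y \<cdot> (\<i>\<d> (Y\<^sup>\<or>) \<star> f))"

text \<open>
  The monoidal structure \<open>Y\<^sup>\<or> \<boxtimes> X\<^sup>\<or> \<rightarrow> (X \<boxtimes> Y)\<^sup>\<or>\<close> and \<open>\<I> \<rightarrow> \<I>\<^sup>\<or>\<close> of the duality functor.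
\<close>

definition dual_tensor :: "'o \<Rightarrow> 'o \<Rightarrow> 'm" where
  "dual_tensor X Y = mate (Y\<^sup>\<or> \<boxtimes> X\<^sup>\<or>) (X \<boxtimes> Y)
     (ev Y \<cdot> (\<i>\<d> (Y\<^sup>\<or>) \<star> (\<l> Y \<cdot> (ev X \<star> \<i>\<d> Y) \<cdot> inv_arrow C (\<a> (X\<^sup>\<or>) X Y)))
       \<cdot> \<a> (Y\<^sup>\<or>) (X\<^sup>\<or>) (X \<boxtimes> Y))"

definition dual_unit :: "'m" where
  "dual_unit = mate \<I> \<I> (\<l> \<I>)"

text \<open>The right duality maps \<open>X \<boxtimes> X\<^sup>\<or> \<rightarrow> \<I>\<close> and \<open>\<I> \<rightarrow> X\<^sup>\<or> \<boxtimes> X\<close>.\<close>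

definition ev_right :: "'o \<Rightarrow> 'm" where
  "ev_right X = ev (X\<^sup>\<or>) \<cdot> (\<delta> X \<star> \<i>\<d> (X\<^sup>\<or>))"

definition coev_right :: "'o \<Rightarrow> 'm" where
  "coev_right X = (\<i>\<d> (X\<^sup>\<or>) \<star> inv_arrow C (\<delta> X)) \<cdot> coev (X\<^sup>\<or>)"

end

text \<open>
  The monoidal structure of the double dual functor is given by the isomorphisms
  \<open>(dual_tensor X Y)\<^sup>\<or>\<inverse> \<circ> dual_tensor Y\<^sup>\<or> X\<^sup>\<or> : X\<^sup>\<or>\<^sup>\<or> \<boxtimes> Y\<^sup>\<or>\<^sup>\<or> \<rightarrow> (X \<boxtimes> Y)\<^sup>\<or>\<^sup>\<or>\<close> and
  \<open>dual_unit\<^sup>\<or>\<inverse> \<circ> dual_unit : \<I> \<rightarrow> \<I>\<^sup>\<or>\<^sup>\<or>\<close>. In \<open>piv_tensor\<close> and \<open>piv_unit\<close> the inverses are moved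
  to the other side.
\<close>

locale finite_pivotal_category =
  abelian_category K C + monoidal_linear_category K C
  for K :: "('k, 'r) ring_scheme"
    and C :: "('k, 'o, 'm, 'z) pivotal_cat_scheme" (structure) +
  assumes finite_linear: "finite_category K C"
    and ten_left_exact:
      "\<lbrakk>V \<in> Obj C; X \<in> Obj C; Y \<in> Obj C; Z \<in> Obj C; short_exact C X Y Z f g\<rbrakk>
        \<Longrightarrow> short_exact C (V \<boxtimes> X) (V \<boxtimes> Y) (V \<boxtimes> Z) (\<i>\<d> V \<star> f) (\<i>\<d> V \<star> g)"
    and ten_right_exact:
      "\<lbrakk>V \<in> Obj C; X \<in> Obj C; Y \<in> Obj C; Z \<in> Obj C; short_exact C X Y Z f g\<rbrakk>
        \<Longrightarrow> short_exact C (X \<boxtimes> V) (Y \<boxtimes> V) (Z \<boxtimes> V) (f \<star> \<i>\<d> V) (g \<star> \<i>\<d> V)"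
    and unit_simple: "simple_object C \<I>"
    and dual_closed: "X \<in> Obj C \<Longrightarrow> X\<^sup>\<or> \<in> Obj C"
    and left_dual: "X \<in> Obj C \<Longrightarrow> is_left_dual C X (X\<^sup>\<or>) (ev X) (coev X)"
    and right_dual: "X \<in> Obj C \<Longrightarrow> \<exists>Y\<in>Obj C. \<exists>e c. is_left_dual C Y X e c"
    and piv_iso: "X \<in> Obj C \<Longrightarrow> iso_arrow C X (X\<^sup>\<or>\<^sup>\<or>) (\<delta> X)"
    and piv_natural:
      "\<lbrakk>X \<in> Obj C; Y \<in> Obj C; f \<in> Arr C X Y\<rbrakk>
        \<Longrightarrow> \<delta> Y \<cdot> f = dual_arrow C (Y\<^sup>\<or>) (X\<^sup>\<or>) (dual_arrow C X Y f) \<cdot> \<delta> X"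
    and piv_tensor:
      "\<lbrakk>X \<in> Obj C; Y \<in> Obj C\<rbrakk>
        \<Longrightarrow> dual_arrow C (Y\<^sup>\<or> \<boxtimes> X\<^sup>\<or>) ((X \<boxtimes> Y)\<^sup>\<or>) (dual_tensor C X Y) \<cdot> \<delta> (X \<boxtimes> Y)
            = dual_tensor C (Y\<^sup>\<or>) (X\<^sup>\<or>) \<cdot> (\<delta> X \<star> \<delta> Y)"
    and piv_unit: "dual_arrow C \<I> (\<I>\<^sup>\<or>) (dual_unit C) \<cdot> \<delta> \<I> = dual_unit C"


section \<open>Calabi--Yau structures and partial traces\<close>

definition linear_form ::
  "('k, 'r) ring_scheme \<Rightarrow> ('k, 'v, 's) module_scheme \<Rightarrow> ('v \<Rightarrow> 'k) \<Rightarrow> bool" where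
  "linear_form K V f \<longleftrightarrow> f \<in> carrier V \<rightarrow> carrier K \<and>
     (\<forall>x\<in>carrier V. \<forall>y\<in>carrier V. f (x \<oplus>\<^bsub>V\<^esub> y) = f x \<oplus>\<^bsub>K\<^esub> f y) \<and>
     (\<forall>c\<in>carrier K. \<forall>x\<in>carrier V. f (c \<odot>\<^bsub>V\<^esub> x) = c \<otimes>\<^bsub>K\<^esub> f x)"

definition nondegenerate_pairing ::
  "('k, 'r) ring_scheme \<Rightarrow> ('k, 'v, 's) module_scheme \<Rightarrow> ('k, 'w, 'u) module_scheme \<Rightarrow>
   ('v \<Rightarrow> 'w \<Rightarrow> 'k) \<Rightarrow> bool" where
  "nondegenerate_pairing K V W \<beta> \<longleftrightarrow>
     (\<forall>x\<in>carrier V. (\<forall>y\<in>carrier W. \<beta> x y = \<zero>\<^bsub>K\<^esub>) \<longrightarrow> x = \<zero>\<^bsub>V\<^esub>) \<and>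
     (\<forall>y\<in>carrier W. (\<forall>x\<in>carrier V. \<beta> x y = \<zero>\<^bsub>K\<^esub>) \<longrightarrow> y = \<zero>\<^bsub>W\<^esub>)"

definition calabi_yau_structure ::
  "('k, 'r) ring_scheme \<Rightarrow> ('k, 'o, 'm, 'z) lin_cat_scheme \<Rightarrow> ('o \<Rightarrow> 'm \<Rightarrow> 'k) \<Rightarrow> bool" where
  "calabi_yau_structure K D t \<longleftrightarrow>
     (\<forall>V\<in>Obj D. linear_form K (Hom D V V) (t V)) \<and>
     (\<forall>V\<in>Obj D. \<forall>W\<in>Obj D. \<forall>a\<in>Arr D V W. \<forall>b\<in>Arr D W V.
        t V (b \<cdot>\<^bsub>D\<^esub> a) = t W (a \<cdot>\<^bsub>D\<^esub> b)) \<and>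
     (\<forall>V\<in>Obj D. \<forall>W\<in>Obj D.
        nondegenerate_pairing K (Hom D V W) (Hom D W V) (\<lambda>a b. t W (a \<cdot>\<^bsub>D\<^esub> b)))"

definition nondegenerate_traces ::
  "('k, 'r) ring_scheme \<Rightarrow> ('k, 'o, 'm, 'z) lin_cat_scheme \<Rightarrow> ('o \<Rightarrow> 'm \<Rightarrow> 'k) \<Rightarrow> bool" where
  "nondegenerate_traces K C t \<longleftrightarrow>
     (\<forall>P\<in>Obj (Proj C). \<forall>M\<in>Obj C.
        nondegenerate_pairing K (Hom C M P) (Hom C P M) (\<lambda>a b. t P (a \<cdot>\<^bsub>C\<^esub> b)))"

context
  fixes C :: "('k, 'o, 'm, 'z) pivotal_cat_scheme" (structure)
begin

text \<open>Here \<open>a : U \<boxtimes> V \<rightarrow> W\<close> and \<open>b : W \<rightarrow> U \<boxtimes> V\<close>.\<close>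

definition d_cup_right :: "'o \<Rightarrow> 'o \<Rightarrow> 'm \<Rightarrow> 'm" where
  "d_cup_right U V a =
     (a \<star> \<i>\<d> (V\<^sup>\<or>)) \<cdot> inv_arrow C (\<a> U V (V\<^sup>\<or>)) \<cdot> (\<i>\<d> U \<star> coev V) \<cdot> inv_arrow C (\<r> U)"

definition d_cap_right :: "'o \<Rightarrow> 'o \<Rightarrow> 'm \<Rightarrow> 'm" where
  "d_cap_right U V b =
     \<r> U \<cdot> (\<i>\<d> U \<star> ev_right C V) \<cdot> \<a> U V (V\<^sup>\<or>) \<cdot> (b \<star> \<i>\<d> (V\<^sup>\<or>))"

definition d_cup_left :: "'o \<Rightarrow> 'o \<Rightarrow> 'm \<Rightarrow> 'm" where
  "d_cup_left U V a =
     (\<i>\<d> (U\<^sup>\<or>) \<star> a) \<cdot> \<a> (U\<^sup>\<or>) U V \<cdot> (coev_right C U \<star> \<i>\<d> V) \<cdot> inv_arrow C (\<l> V)"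

definition d_cap_left :: "'o \<Rightarrow> 'o \<Rightarrow> 'm \<Rightarrow> 'm" where
  "d_cap_left U V b =
     \<l> V \<cdot> (ev U \<star> \<i>\<d> V) \<cdot> inv_arrow C (\<a> (U\<^sup>\<or>) U V) \<cdot> (\<i>\<d> (U\<^sup>\<or>) \<star> b)"

text \<open>For \<open>f : W \<boxtimes> V \<rightarrow> W \<boxtimes> V\<close>, the endomorphism of \<open>W\<close> resp. \<open>V\<close>.\<close>

definition tr_right :: "'o \<Rightarrow> 'o \<Rightarrow> 'm \<Rightarrow> 'm" where
  "tr_right W V f =
     \<r> W \<cdot> (\<i>\<d> W \<star> ev_right C V) \<cdot> \<a> W V (V\<^sup>\<or>) \<cdot> (f \<star> \<i>\<d> (V\<^sup>\<or>))
       \<cdot> inv_arrow C (\<a> W V (V\<^sup>\<or>)) \<cdot> (\<i>\<d> W \<star> coev V) \<cdot> inv_arrow C (\<r> W)"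

definition tr_left :: "'o \<Rightarrow> 'o \<Rightarrow> 'm \<Rightarrow> 'm" where
  "tr_left W V f =
     \<l> V \<cdot> (ev W \<star> \<i>\<d> V) \<cdot> inv_arrow C (\<a> (W\<^sup>\<or>) W V) \<cdot> (\<i>\<d> (W\<^sup>\<or>) \<star> f)
       \<cdot> \<a> (W\<^sup>\<or>) W V \<cdot> (coev_right C W \<star> \<i>\<d> V) \<cdot> inv_arrow C (\<l> V)"

definition compatible_right :: "('o \<Rightarrow> 'm \<Rightarrow> 'k) \<Rightarrow> bool" where
  "compatible_right t \<longleftrightarrow>
     (\<forall>U\<in>Obj (Proj C). \<forall>V\<in>Obj (Proj C). \<forall>W\<in>Obj (Proj C).
        \<forall>a\<in>Arr C (U \<boxtimes> V) W. \<forall>b\<in>Arr C W (U \<boxtimes> V).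
          t (U \<boxtimes> V) (b \<cdot> a) = t U (d_cap_right U V b \<cdot> d_cup_right U V a))"

definition compatible_left :: "('o \<Rightarrow> 'm \<Rightarrow> 'k) \<Rightarrow> bool" where
  "compatible_left t \<longleftrightarrow>
     (\<forall>U\<in>Obj (Proj C). \<forall>V\<in>Obj (Proj C). \<forall>W\<in>Obj (Proj C).
        \<forall>a\<in>Arr C (U \<boxtimes> V) W. \<forall>b\<in>Arr C W (U \<boxtimes> V).
          t (U \<boxtimes> V) (b \<cdot> a) = t V (d_cap_left U V b \<cdot> d_cup_left U V a))"

definition right_partial_trace :: "('o \<Rightarrow> 'm \<Rightarrow> 'k) \<Rightarrow> bool" where
  "right_partial_trace t \<longleftrightarrow>
     (\<forall>P\<in>Obj (Proj C). \<forall>V\<in>Obj C. \<forall>f\<in>Arr C (P \<boxtimes> V) (P \<boxtimes> V).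
        t (P \<boxtimes> V) f = t P (tr_right P V f))"

definition left_partial_trace :: "('o \<Rightarrow> 'm \<Rightarrow> 'k) \<Rightarrow> bool" where
  "left_partial_trace t \<longleftrightarrow>
     (\<forall>P\<in>Obj (Proj C). \<forall>V\<in>Obj C. \<forall>f\<in>Arr C (V \<boxtimes> P) (V \<boxtimes> P).
        t (V \<boxtimes> P) f = t P (tr_left V P f))"

end

end

theory Submission
  imports Defs
begin

text \<open>
  A Calabi--Yau structure on the projectives already has non-degenerate trace maps
  (\<open>calabi_yau_nondegenerate\<close>). Given a projective \<open>P\<close> and any \<open>M\<close>, the object \<open>(M \<boxtimes> P\<^sup>\<or>) \<boxtimes> P\<close> is projective, and the
  two dualities between \<open>P\<close> and \<open>P\<^sup>\<or>\<close> provide a map from it to \<open>M\<close> and a map from \<open>M\<close> into it. An arrow between \<open>M\<close>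
  and \<open>P\<close> that is killed by composing with these maps is zero after tensoring with \<open>P\<^sup>\<or>\<close>, and hence zero by a zigzag
  identity. So the pairing for \<open>M\<close> inherits non-degeneracy from the pairing for a projective object.

  The partial trace of a composite \<open>b \<cdot> a\<close> is \<open>d\<^sup>\<inter>(b) \<cdot> d\<^sub>\<union>(a)\<close>, so that compatibility with
  duality says exactly that \<open>t\<close> has the partial trace property for \<open>P \<boxtimes> V\<close> when \<open>V\<close> is projective too. To pass to
  arbitrary \<open>V\<close> (\<open>partial_trace_property_extends\<close>), one uses the evaluation \<open>q : (P\<^sup>\<or> \<boxtimes> P) \<boxtimes> V \<rightarrow> V\<close>. Its source \<open>Q\<close> is
  projective, and \<open>\<i>\<d> P \<star> q\<close> is split by the coevaluation of \<open>P\<close> (\<open>projective_split\<close>). Thus an endomorphism of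
  \<open>P \<boxtimes> V\<close> factors through \<open>P \<boxtimes> Q\<close>, and both \<open>t\<close> and the partial trace are cyclic for this factorisation, the
  latter because \<open>q\<close> can be moved around the loop (\<open>partial_trace_cyclic\<close>). The last step holds since
  the dual arrow of \<open>q\<close> is adjoint to \<open>q\<close> for both the left and the right duality maps.

  Everything is derived for the right-hand version in a setting that is symmetric under reversal of the
  tensor product, and the left-hand version is its mirror image.
\<close>


section \<open>Arrows with source and target\<close>

context linear_category
begin

text \<open>
  An arrow determines its source and target. Once these are functions, being composable becomes an
  equation between objects, and the simplifier can check all typing conditions on its own.
\<close>

definition arr :: "'m \<Rightarrow> bool" where
  "arr f \<longleftrightarrow> (\<exists>X\<in>Obj C. \<exists>Y\<in>Obj C. f \<in> Arr C X Y)"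

definition src :: "'m \<Rightarrow> 'o" where
  "src f = (THE X. X \<in> Obj C \<and> (\<exists>Y\<in>Obj C. f \<in> Arr C X Y))"

definition tgt :: "'m \<Rightarrow> 'o" where
  "tgt f = (THE Y. Y \<in> Obj C \<and> (\<exists>X\<in>Obj C. f \<in> Arr C X Y))"

lemma Arr_iff [simp]:
  assumes "X \<in> Obj C" "Y \<in> Obj C"
  shows "f \<in> Arr C X Y \<longleftrightarrow> arr f \<and> src f = X \<and> tgt f = Y"
proof -
  have *: "arr f \<and> src f = X' \<and> tgt f = Y'"
    if "X' \<in> Obj C" "Y' \<in> Obj C" "f \<in> Arr C X' Y'" for X' Y'
  proof -
    have "src f = X'" unfolding src_def using that hom_disjoint by (intro the_equality) blast+
    moreover have "tgt f = Y'" unfolding tgt_def using that hom_disjoint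
      by (intro the_equality) blast+
    ultimately show ?thesis using that unfolding arr_def by blast
  qed
  show ?thesis
  proof
    assume "arr f \<and> src f = X \<and> tgt f = Y"
    then show "f \<in> Arr C X Y" using * unfolding arr_def by blast
  qed (use * assms in blast)
qed

lemma arr_Arr: "arr f \<Longrightarrow> src f \<in> Obj C \<and> tgt f \<in> Obj C \<and> f \<in> Arr C (src f) (tgt f)"
  by (metis Arr_iff arr_def)

lemma src_obj [simp]: "arr f \<Longrightarrow> src f \<in> Obj C"
  and tgt_obj [simp]: "arr f \<Longrightarrow> tgt f \<in> Obj C"
  using arr_Arr by blast+

lemma arr_comp [simp]:
  assumes "arr f" "arr g" "src g = tgt f"
  shows "arr (g \<cdot> f)" "src (g \<cdot> f) = src f" "tgt (g \<cdot> f) = tgt g"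
  using comp_closed[of "src f" "tgt f" "tgt g" g f] assms by auto

lemma arr_id [simp]:
  assumes "X \<in> Obj C"
  shows "arr (\<i>\<d> X)" "src (\<i>\<d> X) = X" "tgt (\<i>\<d> X) = X"
  using ident_closed[OF assms] assms by auto

lemma assoc_comp [simp]:
  assumes "arr f" "arr g" "arr h" "src g = tgt f" "src h = tgt g"
  shows "(h \<cdot> g) \<cdot> f = h \<cdot> g \<cdot> f"
  using comp_assoc[of "src f" "tgt f" "tgt g" "tgt h" h g f] assms by auto

lemma id_right [simp]: "arr f \<Longrightarrow> src f = X \<Longrightarrow> f \<cdot> \<i>\<d> X = f"
  using comp_ident_right[of "src f" "tgt f" f] by auto

lemma id_left [simp]: "arr f \<Longrightarrow> tgt f = Y \<Longrightarrow> \<i>\<d> Y \<cdot> f = f"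
  using comp_ident_left[of "src f" "tgt f" f] by auto

text \<open>
  Composites are kept nested to the right. This lemma turns an equation between arrows into a
  rewrite rule that applies inside such a nest; most computations below are chains of its uses.
\<close>

lemma comp_reduce:
  assumes "g \<cdot> f = h" "arr f" "arr g" "src g = tgt f" "arr k" "src f = tgt k"
  shows "g \<cdot> f \<cdot> k = h \<cdot> k"
  using assms assoc_comp[of k f g] by simp

definition iso :: "'m \<Rightarrow> bool" where
  "iso f \<longleftrightarrow> (\<exists>X\<in>Obj C. \<exists>Y\<in>Obj C. iso_arrow C X Y f)"

lemma iso_inv:
  assumes "iso f"
  shows "arr f" "inverse_arrows C (src f) (tgt f) f (inv_arrow C f)"
proof -
  obtain X Y g where XY: "X \<in> Obj C" "Y \<in> Obj C" and g: "inverse_arrows C X Y f g"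
    using assms unfolding iso_def iso_arrow_def by blast
  then have f: "arr f" "src f = X" "tgt f = Y" and "arr g" "src g = Y" "tgt g = X"
    unfolding inverse_arrows_def by auto
  then show "arr f" by simp
  have "g' = g" if "X' \<in> Obj C" "Y' \<in> Obj C" "inverse_arrows C X' Y' f g'" for g' X' Y'
  proof -
    have g': "arr g'" "src g' = Y" "tgt g' = X" "g' \<cdot> f = \<i>\<d> X"
      using that f unfolding inverse_arrows_def by auto
    have "g' = g' \<cdot> f \<cdot> g" using g g' f XY unfolding inverse_arrows_def by auto
    also have "\<dots> = \<i>\<d> X \<cdot> g" using \<open>arr g\<close> \<open>tgt g = X\<close> g' f by (intro comp_reduce) auto
    also have "\<dots> = g" using \<open>arr g\<close> \<open>tgt g = X\<close> by simp
    finally show ?thesis .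
  qed
  then have "inv_arrow C f = g" unfolding inv_arrow_def using XY g by blast
  then show "inverse_arrows C (src f) (tgt f) f (inv_arrow C f)" using g f by simp
qed

lemma inv_arr [simp]:
  assumes "iso f"
  shows "arr (inv_arrow C f)" "src (inv_arrow C f) = tgt f" "tgt (inv_arrow C f) = src f"
    and "inv_arrow C f \<cdot> f = \<i>\<d> (src f)" "f \<cdot> inv_arrow C f = \<i>\<d> (tgt f)"
  using iso_inv[OF assms] unfolding inverse_arrows_def by auto

lemma inv_comp_cancel [simp]:
  assumes "iso f" "arr g"
  shows "src f = tgt g \<Longrightarrow> inv_arrow C f \<cdot> f \<cdot> g = g"
    and "tgt f = tgt g \<Longrightarrow> f \<cdot> inv_arrow C f \<cdot> g = g"
  using assms iso_inv(1)[OF assms(1)] comp_reduce[OF inv_arr(4)[OF assms(1)], of g]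
    comp_reduce[OF inv_arr(5)[OF assms(1)], of g] by auto

lemma isoI:
  assumes "arr f" "arr g" "src g = tgt f" "tgt g = src f" "g \<cdot> f = \<i>\<d> (src f)" "f \<cdot> g = \<i>\<d> (tgt f)"
  shows "iso f" "inv_arrow C f = g"
proof -
  have "inverse_arrows C (src f) (tgt f) f g" using assms unfolding inverse_arrows_def by simp
  then show f: "iso f" using assms(1) unfolding iso_def iso_arrow_def
    by (intro bexI[of _ "src f"] bexI[of _ "tgt f"]) auto
  have "inv_arrow C f = inv_arrow C f \<cdot> f \<cdot> g" using assms f by simp
  also have "\<dots> = g" using f \<open>arr g\<close> \<open>tgt g = src f\<close> by simp
  finally show "inv_arrow C f = g" .
qed

lemma inv_inv [simp]:
  assumes "iso f" shows "inv_arrow C (inv_arrow C f) = f" "iso (inv_arrow C f)"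
  using isoI[of "inv_arrow C f" f] iso_inv(1) assms by auto

lemma iso_cancel_left:
  assumes "iso f" "arr g" "arr h" "src f = tgt g" "src f = tgt h" "f \<cdot> g = f \<cdot> h"
  shows "g = h"
  using inv_comp_cancel(1)[of f g] inv_comp_cancel(1)[of f h] assms by simp

lemma iso_cancel_right:
  assumes "iso f" "arr g" "arr h" "src g = tgt f" "src h = tgt f" "g \<cdot> f = h \<cdot> f"
  shows "g = h"
proof -
  have "g = g \<cdot> f \<cdot> inv_arrow C f" using assms by simp
  also have "\<dots> = (h \<cdot> f) \<cdot> inv_arrow C f"
    using assms iso_inv(1)[OF assms(1)] by (intro comp_reduce) auto
  also have "\<dots> = h" using assms iso_inv(1)[OF assms(1)] by simp
  finally show ?thesis .
qed

lemma inv_comp: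
  assumes "iso f" "iso g" "src g = tgt f"
  shows "iso (g \<cdot> f)" "inv_arrow C (g \<cdot> f) = inv_arrow C f \<cdot> inv_arrow C g"
  using isoI[of "g \<cdot> f" "inv_arrow C f \<cdot> inv_arrow C g"] assms iso_inv(1)[OF assms(1)]
    iso_inv(1)[OF assms(2)] by auto

lemma iso_id [simp]:
  assumes "X \<in> Obj C"
  shows "iso (\<i>\<d> X)" "inv_arrow C (\<i>\<d> X) = \<i>\<d> X"
  using isoI[of "\<i>\<d> X" "\<i>\<d> X"] assms by auto

abbreviation null :: "'o \<Rightarrow> 'o \<Rightarrow> 'm" where
  "null X Y \<equiv> \<zero>\<^bsub>Hom C X Y\<^esub>"

lemma hom_group: "X \<in> Obj C \<Longrightarrow> Y \<in> Obj C \<Longrightarrow> abelian_group (Hom C X Y)"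
  using hom_space module.axioms(2) by blast

lemma arr_null [simp]:
  assumes "X \<in> Obj C" "Y \<in> Obj C"
  shows "arr (null X Y)" "src (null X Y) = X" "tgt (null X Y) = Y"
proof -
  interpret abelian_group "Hom C X Y" using hom_group assms .
  show "arr (null X Y)" "src (null X Y) = X" "tgt (null X Y) = Y"
    using Arr_iff[OF assms, of "null X Y"] zero_closed by blast+
qed

lemma null_unique:
  assumes "X \<in> Obj C" "Y \<in> Obj C" "z \<in> Arr C X Y" "z \<oplus>\<^bsub>Hom C X Y\<^esub> z = z"
  shows "z = null X Y"
proof -
  interpret abelian_group "Hom C X Y" using hom_group assms(1,2) .
  show ?thesis using assms(3,4) by (metis add.l_cancel_one)
qed

lemma null_add: "X \<in> Obj C \<Longrightarrow> Y \<in> Obj C \<Longrightarrow> null X Y \<oplus>\<^bsub>Hom C X Y\<^esub> null X Y = null X Y"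
  by (meson abelian_group.axioms(1) abelian_monoid.l_zero abelian_monoid.zero_closed hom_group)

lemma comp_null_right [simp]:
  assumes "X \<in> Obj C" "arr g" "src g = Y"
  shows "g \<cdot> null X Y = null X (tgt g)"
  using assms comp_add_right[of X Y "tgt g" g "null X Y" "null X Y"] null_add
  by (intro null_unique) auto

lemma comp_null_left [simp]:
  assumes "Z \<in> Obj C" "arr f" "tgt f = Y"
  shows "null Y Z \<cdot> f = null (src f) Z"
  using assms comp_add_left[of "src f" Y Z "null Y Z" "null Y Z" f] null_add
  by (intro null_unique) auto

end


section \<open>Coherence in monoidal categories\<close>

context monoidal_linear_category
begin

declare unit_closed [simp] ten_obj_closed [simp]

lemma arr_ten [simp]:
  assumes "arr f" "arr g"
  shows "arr (f \<star> g)" "src (f \<star> g) = src f \<boxtimes> src g" "tgt (f \<star> g) = tgt f \<boxtimes> tgt g"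
  using ten_closed[of "src f" "tgt f" "src g" "tgt g" f g] assms by auto

lemma ten_id [simp]: "X \<in> Obj C \<Longrightarrow> Y \<in> Obj C \<Longrightarrow> \<i>\<d> X \<star> \<i>\<d> Y = \<i>\<d> (X \<boxtimes> Y)"
  by (rule ten_ident)

lemma interchange:
  assumes "arr f" "arr g" "arr f'" "arr g'" "src g = tgt f" "src g' = tgt f'"
  shows "(g \<star> g') \<cdot> (f \<star> f') = (g \<cdot> f) \<star> (g' \<cdot> f')"
  using assms ten_comp[of "src f" "tgt f" "tgt g" "src f'" "tgt f'" "tgt g'" f g f' g'] by auto

lemma interchange_comp:
  assumes "arr f" "arr g" "arr f'" "arr g'" "src g = tgt f" "src g' = tgt f'"
    "arr k" "tgt k = src f \<boxtimes> src f'"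
  shows "(g \<star> g') \<cdot> (f \<star> f') \<cdot> k = ((g \<cdot> f) \<star> (g' \<cdot> f')) \<cdot> k"
  using assms by (simp flip: interchange)

lemma null_ten [simp]:
  assumes "X \<in> Obj C" "Y \<in> Obj C" "arr g"
  shows "null X Y \<star> g = null (X \<boxtimes> src g) (Y \<boxtimes> tgt g)"
  using assms ten_add_left[of X Y "src g" "tgt g" "null X Y" "null X Y" g] null_add
  by (intro null_unique) auto

lemma iso_ten [simp]:
  assumes "iso f" "iso g"
  shows "iso (f \<star> g)" "inv_arrow C (f \<star> g) = inv_arrow C f \<star> inv_arrow C g"
  using isoI[of "f \<star> g" "inv_arrow C f \<star> inv_arrow C g"] assms iso_inv(1)[OF assms(1)] iso_inv(1)[OF assms(2)]
  by (auto simp: interchange)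

lemma iso_arr_iso: "X \<in> Obj C \<Longrightarrow> Y \<in> Obj C \<Longrightarrow> iso_arrow C X Y f \<longleftrightarrow> iso f \<and> src f = X \<and> tgt f = Y"
  unfolding iso_def iso_arrow_def inverse_arrows_def by auto

lemma assoc_arr [simp]:
  assumes "X \<in> Obj C" "Y \<in> Obj C" "Z \<in> Obj C"
  shows "iso (\<a> X Y Z)" "arr (\<a> X Y Z)"
    "src (\<a> X Y Z) = (X \<boxtimes> Y) \<boxtimes> Z" "tgt (\<a> X Y Z) = X \<boxtimes> (Y \<boxtimes> Z)"
  using assoc_iso[OF assms] assms iso_inv(1) by (auto simp: iso_arr_iso)

lemma unitor_arr [simp]:
  assumes "X \<in> Obj C"
  shows "iso (\<l> X)" "arr (\<l> X)" "src (\<l> X) = \<I> \<boxtimes> X" "tgt (\<l> X) = X"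
    "iso (\<r> X)" "arr (\<r> X)" "src (\<r> X) = X \<boxtimes> \<I>" "tgt (\<r> X) = X"
  using lunit_iso[OF assms] runit_iso[OF assms] assms iso_inv(1) by (auto simp: iso_arr_iso)

lemma assoc_nat:
  assumes "arr f" "arr g" "arr h"
  shows "\<a> (tgt f) (tgt g) (tgt h) \<cdot> ((f \<star> g) \<star> h) = (f \<star> (g \<star> h)) \<cdot> \<a> (src f) (src g) (src h)"
  using assms by (intro assoc_natural) auto

lemma lunit_nat: "arr f \<Longrightarrow> \<l> (tgt f) \<cdot> (\<i>\<d> \<I> \<star> f) = f \<cdot> \<l> (src f)"
  and runit_nat: "arr f \<Longrightarrow> \<r> (tgt f) \<cdot> (f \<star> \<i>\<d> \<I>) = f \<cdot> \<r> (src f)"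
  by (auto intro: lunit_natural runit_natural)

lemma assoc_inv_nat:
  assumes "arr f" "arr g" "arr h"
  shows "((f \<star> g) \<star> h) \<cdot> inv_arrow C (\<a> (src f) (src g) (src h))
    = inv_arrow C (\<a> (tgt f) (tgt g) (tgt h)) \<cdot> (f \<star> (g \<star> h))"
proof (rule iso_cancel_left)
  let ?a = "\<a> (src f) (src g) (src h)" and ?b = "\<a> (tgt f) (tgt g) (tgt h)"
  show "iso ?b" using assms by simp
  have "?b \<cdot> ((f \<star> g) \<star> h) \<cdot> inv_arrow C ?a = ((f \<star> (g \<star> h)) \<cdot> ?a) \<cdot> inv_arrow C ?a"
    using assms by (intro comp_reduce[OF assoc_nat]) auto
  then show "?b \<cdot> ((f \<star> g) \<star> h) \<cdot> inv_arrow C ?a = ?b \<cdot> inv_arrow C ?b \<cdot> (f \<star> (g \<star> h))"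
    using assms by simp
qed (use assms in auto)

lemma runit_inv_nat: "arr f \<Longrightarrow> (f \<star> \<i>\<d> \<I>) \<cdot> inv_arrow C (\<r> (src f)) = inv_arrow C (\<r> (tgt f)) \<cdot> f"
proof (rule iso_cancel_left)
  assume f: "arr f"
  then show "iso (\<r> (tgt f))" by simp
  have "\<r> (tgt f) \<cdot> (f \<star> \<i>\<d> \<I>) \<cdot> inv_arrow C (\<r> (src f)) = (f \<cdot> \<r> (src f)) \<cdot> inv_arrow C (\<r> (src f))"
    using f by (intro comp_reduce[OF runit_nat]) auto
  then show "\<r> (tgt f) \<cdot> (f \<star> \<i>\<d> \<I>) \<cdot> inv_arrow C (\<r> (src f)) = \<r> (tgt f) \<cdot> inv_arrow C (\<r> (tgt f)) \<cdot> f"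
    using f by simp
qed auto

lemma whisker_right:
  "\<lbrakk>arr f; arr g; src g = tgt f; Y \<in> Obj C\<rbrakk> \<Longrightarrow> (g \<cdot> f) \<star> \<i>\<d> Y = (g \<star> \<i>\<d> Y) \<cdot> (f \<star> \<i>\<d> Y)"
  by (simp add: interchange)

lemma whisker_left:
  "\<lbrakk>arr f; arr g; src g = tgt f; Y \<in> Obj C\<rbrakk> \<Longrightarrow> \<i>\<d> Y \<star> (g \<cdot> f) = (\<i>\<d> Y \<star> g) \<cdot> (\<i>\<d> Y \<star> f)"
  by (simp add: interchange)

lemma inv_pentagon:
  assumes [simp]: "W \<in> Obj C" "X \<in> Obj C" "Y \<in> Obj C" "Z \<in> Obj C"
  shows "inv_arrow C (\<a> (W \<boxtimes> X) Y Z) \<cdot> inv_arrow C (\<a> W X (Y \<boxtimes> Z)) =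
    (inv_arrow C (\<a> W X Y) \<star> \<i>\<d> Z) \<cdot> inv_arrow C (\<a> W (X \<boxtimes> Y) Z) \<cdot> (\<i>\<d> W \<star> inv_arrow C (\<a> X Y Z))"
  using arg_cong[OF pentagon[OF assms], of "inv_arrow C"] by (simp add: inv_comp)

lemma inv_triangle:
  assumes [simp]: "X \<in> Obj C" "Y \<in> Obj C"
  shows "(\<r> X \<star> \<i>\<d> Y) \<cdot> inv_arrow C (\<a> X \<I> Y) = \<i>\<d> X \<star> \<l> Y"
  using comp_reduce[OF triangle[OF assms], of "inv_arrow C (\<a> X \<I> Y)"] by simp

lemma unit_ten_faithful:
  assumes "arr f" "arr g" "src f = src g" "tgt f = tgt g" "f \<star> \<i>\<d> \<I> = g \<star> \<i>\<d> \<I>"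
  shows "f = g"
proof (rule iso_cancel_right)
  show "iso (\<r> (src f))" using assms by simp
  show "f \<cdot> \<r> (src f) = g \<cdot> \<r> (src f)" using assms runit_nat[of f] runit_nat[of g] by simp
qed (use assms in auto)

text \<open>
  Kelly's coherence law. By naturality of \<open>\<r>\<close>, tensoring with \<open>\<I>\<close> is faithful, so the law may be
  checked after tensoring with \<open>\<I>\<close>; there it is the pentagon at \<open>X, Y, \<I>, \<I>\<close> with the triangle applied
  on both sides.
\<close>

lemma runit_ten:
  assumes [simp]: "X \<in> Obj C" "Y \<in> Obj C"
  shows "\<r> (X \<boxtimes> Y) = (\<i>\<d> X \<star> \<r> Y) \<cdot> \<a> X Y \<I>"
proof (rule unit_ten_faithful)
  have "\<a> X Y \<I> \<cdot> (\<r> (X \<boxtimes> Y) \<star> \<i>\<d> \<I>) = \<a> X Y \<I> \<cdot> ((\<i>\<d> X \<star> \<i>\<d> Y) \<star> \<l> \<I>) \<cdot> \<a> (X \<boxtimes> Y) \<I> \<I>"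
    using triangle[of "X \<boxtimes> Y" \<I>] by simp
  also have "\<dots> = (\<i>\<d> X \<star> (\<i>\<d> Y \<star> \<l> \<I>)) \<cdot> \<a> X Y (\<I> \<boxtimes> \<I>) \<cdot> \<a> (X \<boxtimes> Y) \<I> \<I>"
    using comp_reduce[OF assoc_nat[of "\<i>\<d> X" "\<i>\<d> Y" "\<l> \<I>"], of "\<a> (X \<boxtimes> Y) \<I> \<I>"] by simp
  also have "\<dots> = (\<i>\<d> X \<star> ((\<i>\<d> Y \<star> \<l> \<I>) \<cdot> \<a> Y \<I> \<I>)) \<cdot> \<a> X (Y \<boxtimes> \<I>) \<I> \<cdot> (\<a> X Y \<I> \<star> \<i>\<d> \<I>)"
    by (simp add: pentagon interchange_comp)
  also have "\<dots> = (\<i>\<d> X \<star> (\<r> Y \<star> \<i>\<d> \<I>)) \<cdot> \<a> X (Y \<boxtimes> \<I>) \<I> \<cdot> (\<a> X Y \<I> \<star> \<i>\<d> \<I>)"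
    by (simp add: triangle)
  also have "\<dots> = \<a> X Y \<I> \<cdot> ((\<i>\<d> X \<star> \<r> Y) \<star> \<i>\<d> \<I>) \<cdot> (\<a> X Y \<I> \<star> \<i>\<d> \<I>)"
    using comp_reduce[OF assoc_nat[of "\<i>\<d> X" "\<r> Y" "\<i>\<d> \<I>"], of "\<a> X Y \<I> \<star> \<i>\<d> \<I>"] by simp
  also have "\<dots> = \<a> X Y \<I> \<cdot> (((\<i>\<d> X \<star> \<r> Y) \<cdot> \<a> X Y \<I>) \<star> \<i>\<d> \<I>)"
    by (simp add: interchange)
  finally show "\<r> (X \<boxtimes> Y) \<star> \<i>\<d> \<I> = ((\<i>\<d> X \<star> \<r> Y) \<cdot> \<a> X Y \<I>) \<star> \<i>\<d> \<I>"
    by (rule iso_cancel_left[rotated 5]) auto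
qed auto

end


section \<open>Duality as an adjunction\<close>

context monoidal_linear_category
begin

lemma left_dualD:
  assumes "is_left_dual C X Y e c" and [simp]: "X \<in> Obj C" "Y \<in> Obj C"
  shows "arr e" "src e = Y \<boxtimes> X" "tgt e = \<I>" "arr c" "src c = \<I>" "tgt c = X \<boxtimes> Y"
    and "\<r> X \<cdot> (\<i>\<d> X \<star> e) \<cdot> \<a> X Y X \<cdot> (c \<star> \<i>\<d> X) \<cdot> inv_arrow C (\<l> X) = \<i>\<d> X"
    and "\<l> Y \<cdot> (e \<star> \<i>\<d> Y) \<cdot> inv_arrow C (\<a> Y X Y) \<cdot> (\<i>\<d> Y \<star> c) \<cdot> inv_arrow C (\<r> Y) = \<i>\<d> Y"
  using assms unfolding is_left_dual_def by auto

text \<open>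
  If \<open>Y\<close> is a left dual of \<open>X\<close>, then \<open>_ \<boxtimes> X\<close> is left adjoint to \<open>_ \<boxtimes> Y\<close>. The map
  \<open>d\<^sub>\<union>\<close> of the compatibility condition is \<open>curry\<close> for the coevaluation of the left duality, and
  \<open>d\<^sup>\<inter>\<close> is \<open>uncurry\<close> for the evaluation of the right duality.
\<close>

definition curry :: "'o \<Rightarrow> 'o \<Rightarrow> 'm \<Rightarrow> 'o \<Rightarrow> 'm \<Rightarrow> 'm" where
  "curry X Y c P f = (f \<star> \<i>\<d> Y) \<cdot> inv_arrow C (\<a> P X Y) \<cdot> (\<i>\<d> P \<star> c) \<cdot> inv_arrow C (\<r> P)"

definition uncurry :: "'o \<Rightarrow> 'o \<Rightarrow> 'm \<Rightarrow> 'o \<Rightarrow> 'm \<Rightarrow> 'm" where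
  "uncurry X Y e Z g = \<r> Z \<cdot> (\<i>\<d> Z \<star> e) \<cdot> \<a> Z Y X \<cdot> (g \<star> \<i>\<d> X)"

lemma arr_curry:
  assumes "is_left_dual C X Y e c" and [simp]: "X \<in> Obj C" "Y \<in> Obj C" "P \<in> Obj C" "arr f" "src f = P \<boxtimes> X"
  shows "arr (curry X Y c P f)" "src (curry X Y c P f) = P" "tgt (curry X Y c P f) = tgt f \<boxtimes> Y"
  using left_dualD[OF assms(1)] unfolding curry_def by auto

lemma arr_uncurry:
  assumes "is_left_dual C X Y e c" and [simp]: "X \<in> Obj C" "Y \<in> Obj C" "Z \<in> Obj C" "arr g" "tgt g = Z \<boxtimes> Y"
  shows "arr (uncurry X Y e Z g)" "src (uncurry X Y e Z g) = src g \<boxtimes> X" "tgt (uncurry X Y e Z g) = Z"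
  using left_dualD[OF assms(1)] unfolding uncurry_def by auto

text \<open>
  Moving \<open>g\<close> to the right end leaves an endomorphism of \<open>Z \<boxtimes> Y\<close>, which coherence identifies with
  \<open>\<i>\<d> Z\<close> tensored with the zigzag of \<open>Y\<close>.
\<close>

lemma curry_uncurry:
  assumes dual: "is_left_dual C X Y e c"
    and [simp]: "X \<in> Obj C" "Y \<in> Obj C" "Z \<in> Obj C" "arr g" "tgt g = Z \<boxtimes> Y" "src g = P"
  shows "curry X Y c P (uncurry X Y e Z g) = g"
proof -
  note [simp] = left_dualD(1-6)[OF dual]
  have [simp]: "P \<in> Obj C" using src_obj[of g] by simp
  have s1: "((g \<star> \<i>\<d> X) \<star> \<i>\<d> Y) \<cdot> inv_arrow C (\<a> P X Y)
      = inv_arrow C (\<a> (Z \<boxtimes> Y) X Y) \<cdot> (g \<star> \<i>\<d> (X \<boxtimes> Y))"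
    using assoc_inv_nat[of g "\<i>\<d> X" "\<i>\<d> Y"] by simp
  have s2: "(g \<star> \<i>\<d> (X \<boxtimes> Y)) \<cdot> (\<i>\<d> P \<star> c) = (\<i>\<d> (Z \<boxtimes> Y) \<star> c) \<cdot> (g \<star> \<i>\<d> \<I>)"
    by (simp add: interchange)
  have s3: "(g \<star> \<i>\<d> \<I>) \<cdot> inv_arrow C (\<r> P) = inv_arrow C (\<a> Z Y \<I>) \<cdot> (\<i>\<d> Z \<star> inv_arrow C (\<r> Y)) \<cdot> g"
    using runit_inv_nat[of g] by (simp add: runit_ten inv_comp)
  have s4: "(\<i>\<d> (Z \<boxtimes> Y) \<star> c) \<cdot> inv_arrow C (\<a> Z Y \<I>)
      = inv_arrow C (\<a> Z Y (X \<boxtimes> Y)) \<cdot> (\<i>\<d> Z \<star> (\<i>\<d> Y \<star> c))"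
    using assoc_inv_nat[of "\<i>\<d> Z" "\<i>\<d> Y" c] by simp
  have s6: "((\<i>\<d> Z \<star> e) \<star> \<i>\<d> Y) \<cdot> inv_arrow C (\<a> Z (Y \<boxtimes> X) Y)
      = inv_arrow C (\<a> Z \<I> Y) \<cdot> (\<i>\<d> Z \<star> (e \<star> \<i>\<d> Y))"
    using assoc_inv_nat[of "\<i>\<d> Z" e "\<i>\<d> Y"] by simp
  have "curry X Y c P (uncurry X Y e Z g) =
      (\<r> Z \<star> \<i>\<d> Y) \<cdot> ((\<i>\<d> Z \<star> e) \<star> \<i>\<d> Y) \<cdot> (\<a> Z Y X \<star> \<i>\<d> Y)
        \<cdot> ((g \<star> \<i>\<d> X) \<star> \<i>\<d> Y) \<cdot> inv_arrow C (\<a> P X Y) \<cdot> (\<i>\<d> P \<star> c) \<cdot> inv_arrow C (\<r> P)"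
    unfolding curry_def uncurry_def by (simp add: whisker_right)
  also have "\<dots> = (\<r> Z \<star> \<i>\<d> Y) \<cdot> ((\<i>\<d> Z \<star> e) \<star> \<i>\<d> Y) \<cdot> (\<a> Z Y X \<star> \<i>\<d> Y)
        \<cdot> inv_arrow C (\<a> (Z \<boxtimes> Y) X Y) \<cdot> inv_arrow C (\<a> Z Y (X \<boxtimes> Y))
        \<cdot> (\<i>\<d> Z \<star> (\<i>\<d> Y \<star> c)) \<cdot> (\<i>\<d> Z \<star> inv_arrow C (\<r> Y)) \<cdot> g"
    by (simp add: comp_reduce[OF s1] comp_reduce[OF s2] s3 comp_reduce[OF s4])
  also have "\<dots> = (\<r> Z \<star> \<i>\<d> Y) \<cdot> ((\<i>\<d> Z \<star> e) \<star> \<i>\<d> Y) \<cdot> inv_arrow C (\<a> Z (Y \<boxtimes> X) Y)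
        \<cdot> (\<i>\<d> Z \<star> inv_arrow C (\<a> Y X Y))
        \<cdot> (\<i>\<d> Z \<star> (\<i>\<d> Y \<star> c)) \<cdot> (\<i>\<d> Z \<star> inv_arrow C (\<r> Y)) \<cdot> g"
    by (simp add: comp_reduce[OF inv_pentagon] interchange_comp)
  also have "\<dots> = (\<i>\<d> Z \<star> \<l> Y) \<cdot> (\<i>\<d> Z \<star> (e \<star> \<i>\<d> Y)) \<cdot> (\<i>\<d> Z \<star> inv_arrow C (\<a> Y X Y))
        \<cdot> (\<i>\<d> Z \<star> (\<i>\<d> Y \<star> c)) \<cdot> (\<i>\<d> Z \<star> inv_arrow C (\<r> Y)) \<cdot> g"
    by (simp add: comp_reduce[OF s6] comp_reduce[OF inv_triangle])
  also have "\<dots> = (\<i>\<d> Z \<star> (\<l> Y \<cdot> (e \<star> \<i>\<d> Y) \<cdot> inv_arrow C (\<a> Y X Y) \<cdot> (\<i>\<d> Y \<star> c) \<cdot> inv_arrow C (\<r> Y))) \<cdot> g"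
    by (simp add: whisker_left)
  also have "\<dots> = g"
    by (simp add: left_dualD(8)[OF dual])
  finally show ?thesis .
qed

text \<open>
  Moving \<open>f\<close> to the left end leaves \<open>\<i>\<d> P\<close> tensored with the zigzag of \<open>X\<close>.
\<close>

lemma uncurry_curry:
  assumes dual: "is_left_dual C X Y e c"
    and [simp]: "X \<in> Obj C" "Y \<in> Obj C" "P \<in> Obj C" "arr f" "src f = P \<boxtimes> X" "tgt f = Z"
  shows "uncurry X Y e Z (curry X Y c P f) = f"
proof -
  note [simp] = left_dualD(1-6)[OF dual]
  have [simp]: "Z \<in> Obj C" using tgt_obj[of f] by simp
  have s1: "\<a> Z Y X \<cdot> ((f \<star> \<i>\<d> Y) \<star> \<i>\<d> X) = (f \<star> \<i>\<d> (Y \<boxtimes> X)) \<cdot> \<a> (P \<boxtimes> X) Y X"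
    using assoc_nat[of f "\<i>\<d> Y" "\<i>\<d> X"] by simp
  have s2: "(\<i>\<d> Z \<star> e) \<cdot> (f \<star> \<i>\<d> (Y \<boxtimes> X)) = (f \<star> \<i>\<d> \<I>) \<cdot> (\<i>\<d> (P \<boxtimes> X) \<star> e)"
    by (simp add: interchange)
  have s3: "\<r> Z \<cdot> (f \<star> \<i>\<d> \<I>) = f \<cdot> (\<i>\<d> P \<star> \<r> X) \<cdot> \<a> P X \<I>"
    using runit_nat[of f] by (simp add: runit_ten)
  have s4: "\<a> P X \<I> \<cdot> (\<i>\<d> (P \<boxtimes> X) \<star> e) = (\<i>\<d> P \<star> (\<i>\<d> X \<star> e)) \<cdot> \<a> P X (Y \<boxtimes> X)"
    using assoc_nat[of "\<i>\<d> P" "\<i>\<d> X" e] by simp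
  have s6: "\<a> P (X \<boxtimes> Y) X \<cdot> ((\<i>\<d> P \<star> c) \<star> \<i>\<d> X) = (\<i>\<d> P \<star> (c \<star> \<i>\<d> X)) \<cdot> \<a> P \<I> X"
    using assoc_nat[of "\<i>\<d> P" c "\<i>\<d> X"] by simp
  have s7: "\<a> P \<I> X \<cdot> (inv_arrow C (\<r> P) \<star> \<i>\<d> X) = \<i>\<d> P \<star> inv_arrow C (\<l> X)"
    using arg_cong[OF inv_triangle[of P X], of "inv_arrow C"] by (simp add: inv_comp)
  have "uncurry X Y e Z (curry X Y c P f) =
      \<r> Z \<cdot> (\<i>\<d> Z \<star> e) \<cdot> \<a> Z Y X \<cdot> ((f \<star> \<i>\<d> Y) \<star> \<i>\<d> X) \<cdot> (inv_arrow C (\<a> P X Y) \<star> \<i>\<d> X)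
        \<cdot> ((\<i>\<d> P \<star> c) \<star> \<i>\<d> X) \<cdot> (inv_arrow C (\<r> P) \<star> \<i>\<d> X)"
    unfolding curry_def uncurry_def by (simp add: whisker_right)
  also have "\<dots> = f \<cdot> (\<i>\<d> P \<star> \<r> X) \<cdot> (\<i>\<d> P \<star> (\<i>\<d> X \<star> e)) \<cdot> \<a> P X (Y \<boxtimes> X) \<cdot> \<a> (P \<boxtimes> X) Y X
        \<cdot> (inv_arrow C (\<a> P X Y) \<star> \<i>\<d> X) \<cdot> ((\<i>\<d> P \<star> c) \<star> \<i>\<d> X) \<cdot> (inv_arrow C (\<r> P) \<star> \<i>\<d> X)"
    by (simp add: comp_reduce[OF s1] comp_reduce[OF s2] comp_reduce[OF s3] comp_reduce[OF s4])
  also have "\<dots> = f \<cdot> (\<i>\<d> P \<star> \<r> X) \<cdot> (\<i>\<d> P \<star> (\<i>\<d> X \<star> e)) \<cdot> (\<i>\<d> P \<star> \<a> X Y X) \<cdot> \<a> P (X \<boxtimes> Y) X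
        \<cdot> ((\<i>\<d> P \<star> c) \<star> \<i>\<d> X) \<cdot> (inv_arrow C (\<r> P) \<star> \<i>\<d> X)"
    by (simp add: comp_reduce[OF pentagon] interchange_comp)
  also have "\<dots> = f \<cdot> (\<i>\<d> P \<star> \<r> X) \<cdot> (\<i>\<d> P \<star> (\<i>\<d> X \<star> e)) \<cdot> (\<i>\<d> P \<star> \<a> X Y X)
        \<cdot> (\<i>\<d> P \<star> (c \<star> \<i>\<d> X)) \<cdot> (\<i>\<d> P \<star> inv_arrow C (\<l> X))"
    by (simp add: comp_reduce[OF s6] s7)
  also have "\<dots> = f \<cdot> (\<i>\<d> P \<star> (\<r> X \<cdot> (\<i>\<d> X \<star> e) \<cdot> \<a> X Y X \<cdot> (c \<star> \<i>\<d> X) \<cdot> inv_arrow C (\<l> X)))"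
    by (simp add: whisker_left)
  also have "\<dots> = f"
    by (simp add: left_dualD(7)[OF dual])
  finally show ?thesis .
qed

lemma curry_comp:
  assumes dual: "is_left_dual C X Y e c"
    and [simp]: "X \<in> Obj C" "Y \<in> Obj C" "P \<in> Obj C" "P' \<in> Obj C" "arr f" "src f = P \<boxtimes> X" "arr b" "src b = P'" "tgt b = P"
  shows "curry X Y c P f \<cdot> b = curry X Y c P' (f \<cdot> (b \<star> \<i>\<d> X))"
proof -
  note [simp] = left_dualD(1-6)[OF dual]
  have s1: "inv_arrow C (\<r> P) \<cdot> b = (b \<star> \<i>\<d> \<I>) \<cdot> inv_arrow C (\<r> P')"
    using runit_inv_nat[of b] by simp
  have s2: "(\<i>\<d> P \<star> c) \<cdot> (b \<star> \<i>\<d> \<I>) = (b \<star> \<i>\<d> (X \<boxtimes> Y)) \<cdot> (\<i>\<d> P' \<star> c)"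
    by (simp add: interchange)
  have s3: "inv_arrow C (\<a> P X Y) \<cdot> (b \<star> \<i>\<d> (X \<boxtimes> Y)) = ((b \<star> \<i>\<d> X) \<star> \<i>\<d> Y) \<cdot> inv_arrow C (\<a> P' X Y)"
    using assoc_inv_nat[of b "\<i>\<d> X" "\<i>\<d> Y"] by simp
  show ?thesis
    unfolding curry_def by (simp add: s1 comp_reduce[OF s2] comp_reduce[OF s3] whisker_right)
qed

lemma comp_uncurry:
  assumes dual: "is_left_dual C X Y e c"
    and [simp]: "X \<in> Obj C" "Y \<in> Obj C" "Z \<in> Obj C" "arr g" "tgt g = Z \<boxtimes> Y" "arr b" "src b = Z" "tgt b = Z'"
  shows "b \<cdot> uncurry X Y e Z g = uncurry X Y e Z' ((b \<star> \<i>\<d> Y) \<cdot> g)"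
proof -
  note [simp] = left_dualD(1-6)[OF dual]
  have [simp]: "Z' \<in> Obj C" using tgt_obj[of b] by simp
  have s1: "b \<cdot> \<r> Z = \<r> Z' \<cdot> (b \<star> \<i>\<d> \<I>)"
    using runit_nat[of b] by simp
  have s2: "(b \<star> \<i>\<d> \<I>) \<cdot> (\<i>\<d> Z \<star> e) = (\<i>\<d> Z' \<star> e) \<cdot> (b \<star> \<i>\<d> (Y \<boxtimes> X))"
    by (simp add: interchange)
  have s3: "(b \<star> \<i>\<d> (Y \<boxtimes> X)) \<cdot> \<a> Z Y X = \<a> Z' Y X \<cdot> ((b \<star> \<i>\<d> Y) \<star> \<i>\<d> X)"
    using assoc_nat[of b "\<i>\<d> Y" "\<i>\<d> X"] by simp
  show ?thesis
    unfolding uncurry_def by (simp add: comp_reduce[OF s1] comp_reduce[OF s2] comp_reduce[OF s3] whisker_right)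
qed

text \<open>
  A map of duals that is adjoint to \<open>f\<close> with respect to the evaluations is also adjoint to \<open>f\<close> with
  respect to the coevaluations: \<open>uncurry\<close> is injective and sends both sides to \<open>f \<cdot> \<l> X\<close>.
\<close>

lemma dual_map_coevaluation:
  assumes X: "is_left_dual C X X' e c" and Y: "is_left_dual C Y Y' d b"
    and [simp]: "X \<in> Obj C" "X' \<in> Obj C" "Y \<in> Obj C" "Y' \<in> Obj C"
      "arr f" "src f = X" "tgt f = Y" "arr p" "src p = Y'" "tgt p = X'"
    and p: "e \<cdot> (p \<star> \<i>\<d> X) = d \<cdot> (\<i>\<d> Y' \<star> f)"
  shows "(f \<star> \<i>\<d> X') \<cdot> c = (\<i>\<d> Y \<star> p) \<cdot> b"
proof -
  note [simp] = left_dualD(1-6)[OF X] left_dualD(1-6)[OF Y]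
  have zig: "\<r> V \<cdot> (\<i>\<d> V \<star> e) \<cdot> \<a> V V' V \<cdot> (c \<star> \<i>\<d> V) = \<l> V"
    if "is_left_dual C V V' e c" and [simp]: "V \<in> Obj C" "V' \<in> Obj C" for V V' e c
  proof (rule iso_cancel_right[of "inv_arrow C (\<l> V)"])
    show "(\<r> V \<cdot> (\<i>\<d> V \<star> e) \<cdot> \<a> V V' V \<cdot> (c \<star> \<i>\<d> V)) \<cdot> inv_arrow C (\<l> V) = \<l> V \<cdot> inv_arrow C (\<l> V)"
      using left_dualD[OF that] by simp
  qed (use left_dualD[OF that] in auto)
  have 1: "uncurry X X' e Y ((f \<star> \<i>\<d> X') \<cdot> c) = f \<cdot> \<l> X"
    using comp_uncurry[OF X, of X c f Y] zig[OF X] unfolding uncurry_def by simp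
  have s1: "\<a> Y X' X \<cdot> ((\<i>\<d> Y \<star> p) \<star> \<i>\<d> X) = (\<i>\<d> Y \<star> (p \<star> \<i>\<d> X)) \<cdot> \<a> Y Y' X"
    using assoc_nat[of "\<i>\<d> Y" p "\<i>\<d> X"] by simp
  have s2: "(\<i>\<d> Y \<star> e) \<cdot> (\<i>\<d> Y \<star> (p \<star> \<i>\<d> X)) = (\<i>\<d> Y \<star> d) \<cdot> (\<i>\<d> Y \<star> (\<i>\<d> Y' \<star> f))"
    by (simp add: p flip: whisker_left)
  have s3: "(\<i>\<d> Y \<star> (\<i>\<d> Y' \<star> f)) \<cdot> \<a> Y Y' X = \<a> Y Y' Y \<cdot> (\<i>\<d> (Y \<boxtimes> Y') \<star> f)"
    using assoc_nat[of "\<i>\<d> Y" "\<i>\<d> Y'" f] by simp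
  have s4: "(\<i>\<d> (Y \<boxtimes> Y') \<star> f) \<cdot> (b \<star> \<i>\<d> X) = (b \<star> \<i>\<d> Y) \<cdot> (\<i>\<d> \<I> \<star> f)"
    by (simp add: interchange)
  have "uncurry X X' e Y ((\<i>\<d> Y \<star> p) \<cdot> b)
      = \<r> Y \<cdot> (\<i>\<d> Y \<star> d) \<cdot> \<a> Y Y' Y \<cdot> (b \<star> \<i>\<d> Y) \<cdot> (\<i>\<d> \<I> \<star> f)"
    unfolding uncurry_def
    by (simp add: whisker_right comp_reduce[OF s1] comp_reduce[OF s2] comp_reduce[OF s3] s4)
  also have "\<dots> = (\<r> Y \<cdot> (\<i>\<d> Y \<star> d) \<cdot> \<a> Y Y' Y \<cdot> (b \<star> \<i>\<d> Y)) \<cdot> (\<i>\<d> \<I> \<star> f)" by simp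
  also have "\<dots> = f \<cdot> \<l> X"
    using lunit_nat[of f] by (subst zig[OF Y]) auto
  finally have eq: "uncurry X X' e Y ((f \<star> \<i>\<d> X') \<cdot> c) = uncurry X X' e Y ((\<i>\<d> Y \<star> p) \<cdot> b)"
    using 1 by simp
  have "(f \<star> \<i>\<d> X') \<cdot> c = curry X X' c \<I> (uncurry X X' e Y ((f \<star> \<i>\<d> X') \<cdot> c))"
    by (subst curry_uncurry[OF X]) auto
  also have "\<dots> = curry X X' c \<I> (uncurry X X' e Y ((\<i>\<d> Y \<star> p) \<cdot> b))"
    by (simp only: eq)
  also have "\<dots> = (\<i>\<d> Y \<star> p) \<cdot> b"
    by (rule curry_uncurry[OF X]) auto
  finally show ?thesis .
qed

text \<open>
  In the first zigzag, \<open>d\<close> and its inverse meet and cancel. In the second one they slide to the two ends, so that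
  the zigzag of \<open>Y\<close> is conjugated by \<open>d\<close>.
\<close>

lemma left_dual_along_iso:
  assumes dual: "is_left_dual C X Y e c" and [simp]: "X \<in> Obj C" "Y \<in> Obj C" "Z \<in> Obj C"
    and [simp]: "iso d" "src d = Z" "tgt d = Y"
  shows "is_left_dual C X Z (e \<cdot> (d \<star> \<i>\<d> X)) ((\<i>\<d> X \<star> inv_arrow C d) \<cdot> c)"
proof -
  note [simp] = left_dualD(1-6)[OF dual]
  have [simp]: "arr d" by (rule iso_inv(1)) simp
  let ?d = "inv_arrow C d"
  have s1: "(\<i>\<d> X \<star> (d \<star> \<i>\<d> X)) \<cdot> \<a> X Z X = \<a> X Y X \<cdot> ((\<i>\<d> X \<star> d) \<star> \<i>\<d> X)"
    using assoc_nat[of "\<i>\<d> X" d "\<i>\<d> X"] by simp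
  have "\<r> X \<cdot> (\<i>\<d> X \<star> (e \<cdot> (d \<star> \<i>\<d> X))) \<cdot> \<a> X Z X \<cdot> (((\<i>\<d> X \<star> ?d) \<cdot> c) \<star> \<i>\<d> X) \<cdot> inv_arrow C (\<l> X)
      = \<r> X \<cdot> (\<i>\<d> X \<star> e) \<cdot> \<a> X Y X \<cdot> ((\<i>\<d> X \<star> d) \<star> \<i>\<d> X) \<cdot> ((\<i>\<d> X \<star> ?d) \<star> \<i>\<d> X)
        \<cdot> (c \<star> \<i>\<d> X) \<cdot> inv_arrow C (\<l> X)"
    by (simp add: whisker_left whisker_right comp_reduce[OF s1])
  also have "\<dots> = \<i>\<d> X"
    by (simp add: interchange_comp left_dualD(7)[OF dual])
  finally have zig: "\<r> X \<cdot> (\<i>\<d> X \<star> (e \<cdot> (d \<star> \<i>\<d> X))) \<cdot> \<a> X Z X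
      \<cdot> (((\<i>\<d> X \<star> ?d) \<cdot> c) \<star> \<i>\<d> X) \<cdot> inv_arrow C (\<l> X) = \<i>\<d> X" .
  have s2: "((d \<star> \<i>\<d> X) \<star> \<i>\<d> Z) \<cdot> inv_arrow C (\<a> Z X Z) = inv_arrow C (\<a> Y X Z) \<cdot> (d \<star> \<i>\<d> (X \<boxtimes> Z))"
    using assoc_inv_nat[of d "\<i>\<d> X" "\<i>\<d> Z"] by simp
  have s3: "(d \<star> \<i>\<d> (X \<boxtimes> Z)) \<cdot> (\<i>\<d> Z \<star> (\<i>\<d> X \<star> ?d)) = (\<i>\<d> Y \<star> (\<i>\<d> X \<star> ?d)) \<cdot> (d \<star> \<i>\<d> (X \<boxtimes> Y))"
    by (simp add: interchange)
  have s4: "(d \<star> \<i>\<d> (X \<boxtimes> Y)) \<cdot> (\<i>\<d> Z \<star> c) = (\<i>\<d> Y \<star> c) \<cdot> (d \<star> \<i>\<d> \<I>)"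
    by (simp add: interchange)
  have s5: "(d \<star> \<i>\<d> \<I>) \<cdot> inv_arrow C (\<r> Z) = inv_arrow C (\<r> Y) \<cdot> d"
    using runit_inv_nat[of d] by simp
  have s6: "inv_arrow C (\<a> Y X Z) \<cdot> (\<i>\<d> Y \<star> (\<i>\<d> X \<star> ?d)) = (\<i>\<d> (Y \<boxtimes> X) \<star> ?d) \<cdot> inv_arrow C (\<a> Y X Y)"
    using assoc_inv_nat[of "\<i>\<d> Y" "\<i>\<d> X" ?d] by simp
  have s7: "(e \<star> \<i>\<d> Z) \<cdot> (\<i>\<d> (Y \<boxtimes> X) \<star> ?d) = (\<i>\<d> \<I> \<star> ?d) \<cdot> (e \<star> \<i>\<d> Y)"
    by (simp add: interchange)
  have s8: "\<l> Z \<cdot> (\<i>\<d> \<I> \<star> ?d) = ?d \<cdot> \<l> Y"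
    using lunit_nat[of ?d] by simp
  have "\<l> Z \<cdot> ((e \<cdot> (d \<star> \<i>\<d> X)) \<star> \<i>\<d> Z) \<cdot> inv_arrow C (\<a> Z X Z) \<cdot> (\<i>\<d> Z \<star> ((\<i>\<d> X \<star> ?d) \<cdot> c)) \<cdot> inv_arrow C (\<r> Z)
      = \<l> Z \<cdot> (e \<star> \<i>\<d> Z) \<cdot> inv_arrow C (\<a> Y X Z) \<cdot> (\<i>\<d> Y \<star> (\<i>\<d> X \<star> ?d)) \<cdot> (\<i>\<d> Y \<star> c) \<cdot> inv_arrow C (\<r> Y) \<cdot> d"
    by (simp add: whisker_left whisker_right comp_reduce[OF s2] comp_reduce[OF s3] comp_reduce[OF s4] s5)
  also have "\<dots> = ?d \<cdot> (\<l> Y \<cdot> (e \<star> \<i>\<d> Y) \<cdot> inv_arrow C (\<a> Y X Y) \<cdot> (\<i>\<d> Y \<star> c) \<cdot> inv_arrow C (\<r> Y)) \<cdot> d"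
    by (simp add: comp_reduce[OF s6] comp_reduce[OF s7] comp_reduce[OF s8])
  also have "\<dots> = \<i>\<d> Z"
    by (subst left_dualD(8)[OF dual]) auto
  finally show ?thesis using zig unfolding is_left_dual_def by simp
qed

end


section \<open>The reversed tensor product\<close>

text \<open>
  Reversing the tensor product turns left duals into right duals and partial traces on the right
  into partial traces on the left, so that each result on the right gives the one on the left.
\<close>

definition reversed :: "('k, 'o, 'm, 'z) monoidal_cat_scheme \<Rightarrow> ('k, 'o, 'm, 'z) monoidal_cat_scheme" where
  "reversed C = C\<lparr>TenObj := (\<lambda>X Y. Y \<boxtimes>\<^bsub>C\<^esub> X), TenArr := (\<lambda>f g. g \<star>\<^bsub>C\<^esub> f),
     Assoc := (\<lambda>X Y Z. inv_arrow C (\<a>\<^bsub>C\<^esub> Z Y X)), LUnit := \<r>\<^bsub>C\<^esub>, RUnit := \<l>\<^bsub>C\<^esub>\<rparr>"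

lemma reversed_simps [simp]:
  "Obj (reversed C) = Obj C" "Hom (reversed C) = Hom C" "Comp (reversed C) = Comp C"
  "Ident (reversed C) = Ident C" "UnitObj (reversed C) = UnitObj C"
  "TenObj (reversed C) X Y = TenObj C Y X" "TenArr (reversed C) f g = TenArr C g f"
  "Assoc (reversed C) X Y Z = inv_arrow C (Assoc C Z Y X)"
  "LUnit (reversed C) = RUnit C" "RUnit (reversed C) = LUnit C"
  by (simp_all add: reversed_def)

lemma reversed_underlying [simp]:
  "inv_arrow (reversed C) = inv_arrow C" "iso_arrow (reversed C) = iso_arrow C"
  "epic (reversed C) = epic C" "projective_object (reversed C) = projective_object C"
  by (simp_all add: fun_eq_iff inv_arrow_def iso_arrow_def inverse_arrows_def epic_def
      projective_object_def)

lemma calabi_yau_reversed [simp]: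
  "calabi_yau_structure K (Proj (reversed C)) t \<longleftrightarrow> calabi_yau_structure K (Proj C) t"
  by (simp add: calabi_yau_structure_def Proj_def)

context monoidal_linear_category
begin

lemma reversed_linear: "linear_category K (reversed C)"
  using linear_category_axioms unfolding linear_category_def by simp

lemma reversed_monoidal: "monoidal_linear_category K (reversed C)"
proof (intro monoidal_linear_category.intro reversed_linear monoidal_linear_category_axioms.intro,
    unfold reversed_simps reversed_underlying)
  fix W X Y Z assume [simp]: "W \<in> Obj C" "X \<in> Obj C" "Y \<in> Obj C" "Z \<in> Obj C"
  show "inv_arrow C (\<a> (Z \<boxtimes> Y) X W) \<cdot> inv_arrow C (\<a> Z Y (X \<boxtimes> W)) =
    (inv_arrow C (\<a> Z Y X) \<star> \<i>\<d> W) \<cdot> inv_arrow C (\<a> Z (Y \<boxtimes> X) W) \<cdot> (\<i>\<d> Z \<star> inv_arrow C (\<a> Y X W))"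
    by (rule inv_pentagon) auto
next
  fix X Y assume [simp]: "X \<in> Obj C" "Y \<in> Obj C"
  show "(\<r> Y \<star> \<i>\<d> X) \<cdot> inv_arrow C (\<a> Y \<I> X) = \<i>\<d> Y \<star> \<l> X"
    by (rule inv_triangle) auto
next
  fix X Y Z X' Y' Z' f g h
  assume [simp]: "X \<in> Obj C" "Y \<in> Obj C" "Z \<in> Obj C" "X' \<in> Obj C" "Y' \<in> Obj C" "Z' \<in> Obj C"
    and "f \<in> Arr C X X'" "g \<in> Arr C Y Y'" "h \<in> Arr C Z Z'"
  then show "inv_arrow C (\<a> Z' Y' X') \<cdot> (h \<star> (g \<star> f)) = ((h \<star> g) \<star> f) \<cdot> inv_arrow C (\<a> Z Y X)"
    using assoc_inv_nat[of h g f] by simp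
qed (auto simp: interchange iso_arr_iso lunit_natural runit_natural ten_add_left ten_add_right ten_smult_left ten_smult_right)

lemma reversed_left_dual:
  assumes [simp]: "X \<in> Obj C" "Y \<in> Obj C"
  shows "is_left_dual (reversed C) X Y e c \<longleftrightarrow> is_left_dual C Y X e c"
  unfolding is_left_dual_def by auto

text \<open>Kelly's law for the left unitor is the one for the right unitor in the reversed category.\<close>

lemma lunit_ten:
  assumes [simp]: "X \<in> Obj C" "Y \<in> Obj C"
  shows "\<l> (X \<boxtimes> Y) \<cdot> \<a> \<I> X Y = \<l> X \<star> \<i>\<d> Y"
proof -
  have "\<l> (X \<boxtimes> Y) = (\<l> X \<star> \<i>\<d> Y) \<cdot> inv_arrow C (\<a> \<I> X Y)"
    using monoidal_linear_category.runit_ten[OF reversed_monoidal, of Y X] by simp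
  then show ?thesis by simp
qed

text \<open>
  After tensoring with \<open>\<I>\<close>, both sides become \<open>(\<i>\<d> \<I> \<star> \<l> \<I>) \<cdot> \<a> \<I> \<I> \<I>\<close>: the left one by Kelly's law, as
  \<open>\<l> (\<I> \<boxtimes> \<I>) = \<i>\<d> \<I> \<star> \<l> \<I>\<close> by naturality, and the right one by the triangle.
\<close>

lemma unitors_unit: "\<l> \<I> = \<r> \<I>"
proof (rule unit_ten_faithful)
  have "\<l> \<I> \<cdot> (\<i>\<d> \<I> \<star> \<l> \<I>) = \<l> \<I> \<cdot> \<l> (\<I> \<boxtimes> \<I>)"
    using lunit_nat[of "\<l> \<I>"] by simp
  then have "\<l> (\<I> \<boxtimes> \<I>) = \<i>\<d> \<I> \<star> \<l> \<I>"
    using iso_cancel_left[of "\<l> \<I>" "\<l> (\<I> \<boxtimes> \<I>)" "\<i>\<d> \<I> \<star> \<l> \<I>"] by simp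
  then show "\<l> \<I> \<star> \<i>\<d> \<I> = \<r> \<I> \<star> \<i>\<d> \<I>"
    using lunit_ten[of \<I> \<I>] triangle[of \<I> \<I>] by simp
qed auto

end


section \<open>Categories with two-sided duals\<close>

lemma Proj_simps [simp]:
  "Obj (Proj C) = {P. projective_object C P}" "Hom (Proj C) = Hom C"
  "Comp (Proj C) = Comp C" "Ident (Proj C) = Ident C"
  by (auto simp: Proj_def projective_object_def)

lemma calabi_yau_cyclic:
  assumes "calabi_yau_structure K (Proj C) t" "projective_object C V" "projective_object C W"
    "a \<in> Arr C V W" "b \<in> Arr C W V"
  shows "t V (b \<cdot>\<^bsub>C\<^esub> a) = t W (a \<cdot>\<^bsub>C\<^esub> b)"
  using assms unfolding calabi_yau_structure_def Proj_simps by blast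

lemma calabi_yau_pairing:
  assumes "calabi_yau_structure K (Proj C) t" "projective_object C V" "projective_object C W"
  shows "nondegenerate_pairing K (Hom C V W) (Hom C W V) (\<lambda>a b. t W (a \<cdot>\<^bsub>C\<^esub> b))"
  using assms unfolding calabi_yau_structure_def Proj_simps by blast

lemma projective_obj: "projective_object C P \<Longrightarrow> P \<in> Obj C"
  by (simp add: projective_object_def)

text \<open>
  Duality data in a form that is symmetric under reversal of the tensor product: \<open>D X\<close> is both
  a left dual of \<open>X\<close>, by \<open>e\<close> and \<open>c\<close>, and a right dual, by \<open>e'\<close> and \<open>c'\<close>; each arrow has one adjoint \<open>p\<close> that serves both
  dualities, which is where naturality of the pivotal structure enters; and the tensor product
  preserves epimorphisms. Exchanging \<open>e, c\<close> with \<open>e', c'\<close> passes to the reversed category.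
\<close>

locale two_sided_duals = monoidal_linear_category K C
  for K :: "('k, 'r) ring_scheme"
    and C :: "('k, 'o, 'm, 'z) monoidal_cat_scheme" (structure) +
  fixes D :: "'o \<Rightarrow> 'o" and e c e' c' :: "'o \<Rightarrow> 'm"
  assumes D_obj [simp]: "X \<in> Obj C \<Longrightarrow> D X \<in> Obj C"
    and left: "X \<in> Obj C \<Longrightarrow> is_left_dual C X (D X) (e X) (c X)"
    and right: "X \<in> Obj C \<Longrightarrow> is_left_dual C (D X) X (e' X) (c' X)"
    and dual_map: "\<lbrakk>X \<in> Obj C; Y \<in> Obj C; f \<in> Arr C X Y\<rbrakk> \<Longrightarrow> \<exists>p\<in>Arr C (D Y) (D X).
        (f \<star> \<i>\<d> (D X)) \<cdot> c X = (\<i>\<d> Y \<star> p) \<cdot> c Y \<and>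
        e' X \<cdot> (\<i>\<d> X \<star> p) = e' Y \<cdot> (f \<star> \<i>\<d> (D Y)) \<and>
        (\<i>\<d> (D X) \<star> f) \<cdot> c' X = (p \<star> \<i>\<d> Y) \<cdot> c' Y \<and>
        e X \<cdot> (p \<star> \<i>\<d> X) = e Y \<cdot> (\<i>\<d> (D Y) \<star> f)"
    and epic_ten_right: "\<lbrakk>X \<in> Obj C; Y \<in> Obj C; V \<in> Obj C; epic C X Y f\<rbrakk>
        \<Longrightarrow> epic C (X \<boxtimes> V) (Y \<boxtimes> V) (f \<star> \<i>\<d> V)"
    and epic_ten_left: "\<lbrakk>X \<in> Obj C; Y \<in> Obj C; V \<in> Obj C; epic C X Y f\<rbrakk>
        \<Longrightarrow> epic C (V \<boxtimes> X) (V \<boxtimes> Y) (\<i>\<d> V \<star> f)"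
begin

lemma two_sided_duals_reversed: "two_sided_duals K (reversed C) D e' c' e c"
proof (intro two_sided_duals.intro reversed_monoidal two_sided_duals_axioms.intro,
    unfold reversed_simps reversed_underlying)
  fix X Y f assume "X \<in> Obj C" "Y \<in> Obj C" "f \<in> Arr C X Y"
  from dual_map[OF this]
  show "\<exists>p\<in>Arr C (D Y) (D X).
        (\<i>\<d> (D X) \<star> f) \<cdot> c' X = (p \<star> \<i>\<d> Y) \<cdot> c' Y \<and>
        e X \<cdot> (p \<star> \<i>\<d> X) = e Y \<cdot> (\<i>\<d> (D Y) \<star> f) \<and>
        (f \<star> \<i>\<d> (D X)) \<cdot> c X = (\<i>\<d> Y \<star> p) \<cdot> c Y \<and>
        e' X \<cdot> (\<i>\<d> X \<star> p) = e' Y \<cdot> (f \<star> \<i>\<d> (D Y))"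
    by blast
qed (use left right epic_ten_left epic_ten_right in \<open>simp_all add: reversed_left_dual\<close>)

lemma duality_arr [simp]:
  assumes "X \<in> Obj C"
  shows "arr (e X)" "src (e X) = D X \<boxtimes> X" "tgt (e X) = \<I>"
    "arr (c X)" "src (c X) = \<I>" "tgt (c X) = X \<boxtimes> D X"
    "arr (e' X)" "src (e' X) = X \<boxtimes> D X" "tgt (e' X) = \<I>"
    "arr (c' X)" "src (c' X) = \<I>" "tgt (c' X) = D X \<boxtimes> X"
  using left_dualD(1-6)[OF left[OF assms]] left_dualD(1-6)[OF right[OF assms]] assms by auto

text \<open>
  \<open>Hom(P \<boxtimes> X, Y) = Hom(P, Y \<boxtimes> D X)\<close> naturally in \<open>Y\<close>, and tensoring with \<open>D X\<close> preserves epimorphisms.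
\<close>

lemma projective_ten_right:
  assumes P: "projective_object C P" and X [simp]: "X \<in> Obj C"
  shows "projective_object C (P \<boxtimes> X)"
  unfolding projective_object_def
proof (intro conjI ballI allI impI)
  have [simp]: "P \<in> Obj C" using P by (rule projective_obj)
  then show "P \<boxtimes> X \<in> Obj C" by simp
  fix Y Z q f assume [simp]: "Y \<in> Obj C" "Z \<in> Obj C"
    and *: "epic C Y Z q \<and> f \<in> Arr C (P \<boxtimes> X) Z"
  then have q [simp]: "arr q" "src q = Y" "tgt q = Z" and f [simp]: "arr f" "src f = P \<boxtimes> X" "tgt f = Z"
    unfolding epic_def by auto
  let ?f = "curry X (D X) (c X) P f"
  have "?f \<in> Arr C P (Z \<boxtimes> D X)" using arr_curry[OF left[OF X], of P f] by simp
  moreover have "epic C (Y \<boxtimes> D X) (Z \<boxtimes> D X) (q \<star> \<i>\<d> (D X))" using * by (intro epic_ten_right) auto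
  ultimately obtain g where "g \<in> Arr C P (Y \<boxtimes> D X)" and g: "(q \<star> \<i>\<d> (D X)) \<cdot> g = ?f"
    using P unfolding projective_object_def by (meson D_obj X \<open>Y \<in> Obj C\<close> \<open>Z \<in> Obj C\<close> ten_obj_closed)
  then have [simp]: "arr g" "src g = P" "tgt g = Y \<boxtimes> D X" by auto
  have "q \<cdot> uncurry X (D X) (e X) Y g = uncurry X (D X) (e X) Z ?f"
    using comp_uncurry[OF left[OF X], of Y g q Z] g by simp
  also have "\<dots> = f" by (rule uncurry_curry[OF left[OF X]]) auto
  finally show "\<exists>h\<in>Arr C (P \<boxtimes> X) Y. q \<cdot> h = f"
    using arr_uncurry[OF left[OF X], of Y g] by (intro bexI[of _ "uncurry X (D X) (e X) Y g"]) auto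
qed

lemma projective_ten_left:
  assumes "projective_object C P" "X \<in> Obj C"
  shows "projective_object C (X \<boxtimes> P)"
  using two_sided_duals.projective_ten_right[OF two_sided_duals_reversed, of P X] assms by simp

text \<open>
  In a pivotal category this is \<open>tr_right\<close>; in the reversed category, with the dualities exchanged, it
  is \<open>tr_left\<close> with its two objects exchanged.
\<close>

definition partial_trace :: "'o \<Rightarrow> 'o \<Rightarrow> 'm \<Rightarrow> 'm" where
  "partial_trace W V f =
     \<r> W \<cdot> (\<i>\<d> W \<star> e' V) \<cdot> \<a> W V (D V) \<cdot> (f \<star> \<i>\<d> (D V))
       \<cdot> inv_arrow C (\<a> W V (D V)) \<cdot> (\<i>\<d> W \<star> c V) \<cdot> inv_arrow C (\<r> W)"

text \<open>
  Partial traces are cyclic for arrows of the traced factor: \<open>f\<close> is pulled through the coevaluation,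
  becomes its adjoint \<open>p\<close>, slides past \<open>s\<close> and turns back into \<open>f\<close> at the evaluation.
\<close>

lemma partial_trace_cyclic:
  assumes [simp]: "W \<in> Obj C" "Q \<in> Obj C" "V \<in> Obj C" "arr f" "src f = Q" "tgt f = V"
    "arr s" "src s = W \<boxtimes> V" "tgt s = W \<boxtimes> Q"
  shows "partial_trace W Q (s \<cdot> (\<i>\<d> W \<star> f)) = partial_trace W V ((\<i>\<d> W \<star> f) \<cdot> s)"
proof -
  obtain p where "p \<in> Arr C (D V) (D Q)"
    and pc: "(f \<star> \<i>\<d> (D Q)) \<cdot> c Q = (\<i>\<d> V \<star> p) \<cdot> c V"
    and pe: "e' Q \<cdot> (\<i>\<d> Q \<star> p) = e' V \<cdot> (f \<star> \<i>\<d> (D V))"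
    using dual_map[of Q V f] by auto
  then have [simp]: "arr p" "src p = D V" "tgt p = D Q" by auto
  have t1: "((\<i>\<d> W \<star> f) \<star> \<i>\<d> (D Q)) \<cdot> inv_arrow C (\<a> W Q (D Q))
      = inv_arrow C (\<a> W V (D Q)) \<cdot> (\<i>\<d> W \<star> (f \<star> \<i>\<d> (D Q)))"
    using assoc_inv_nat[of "\<i>\<d> W" f "\<i>\<d> (D Q)"] by simp
  have t2: "(\<i>\<d> W \<star> (f \<star> \<i>\<d> (D Q))) \<cdot> (\<i>\<d> W \<star> c Q) = (\<i>\<d> W \<star> (\<i>\<d> V \<star> p)) \<cdot> (\<i>\<d> W \<star> c V)"
    by (simp add: pc flip: whisker_left)
  have t3: "inv_arrow C (\<a> W V (D Q)) \<cdot> (\<i>\<d> W \<star> (\<i>\<d> V \<star> p))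
      = (\<i>\<d> (W \<boxtimes> V) \<star> p) \<cdot> inv_arrow C (\<a> W V (D V))"
    using assoc_inv_nat[of "\<i>\<d> W" "\<i>\<d> V" p] by simp
  have t4: "(s \<star> \<i>\<d> (D Q)) \<cdot> (\<i>\<d> (W \<boxtimes> V) \<star> p) = (\<i>\<d> (W \<boxtimes> Q) \<star> p) \<cdot> (s \<star> \<i>\<d> (D V))"
    by (simp add: interchange)
  have t5: "\<a> W Q (D Q) \<cdot> (\<i>\<d> (W \<boxtimes> Q) \<star> p) = (\<i>\<d> W \<star> (\<i>\<d> Q \<star> p)) \<cdot> \<a> W Q (D V)"
    using assoc_nat[of "\<i>\<d> W" "\<i>\<d> Q" p] by simp
  have t6: "(\<i>\<d> W \<star> e' Q) \<cdot> (\<i>\<d> W \<star> (\<i>\<d> Q \<star> p)) = (\<i>\<d> W \<star> e' V) \<cdot> (\<i>\<d> W \<star> (f \<star> \<i>\<d> (D V)))"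
    by (simp add: pe flip: whisker_left)
  have t7: "(\<i>\<d> W \<star> (f \<star> \<i>\<d> (D V))) \<cdot> \<a> W Q (D V) = \<a> W V (D V) \<cdot> ((\<i>\<d> W \<star> f) \<star> \<i>\<d> (D V))"
    using assoc_nat[of "\<i>\<d> W" f "\<i>\<d> (D V)"] by simp
  have "partial_trace W Q (s \<cdot> (\<i>\<d> W \<star> f)) =
      \<r> W \<cdot> (\<i>\<d> W \<star> e' Q) \<cdot> \<a> W Q (D Q) \<cdot> (s \<star> \<i>\<d> (D Q)) \<cdot> (\<i>\<d> (W \<boxtimes> V) \<star> p)
        \<cdot> inv_arrow C (\<a> W V (D V)) \<cdot> (\<i>\<d> W \<star> c V) \<cdot> inv_arrow C (\<r> W)"
    unfolding partial_trace_def
    by (simp add: whisker_right comp_reduce[OF t1] comp_reduce[OF t2] comp_reduce[OF t3])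
  also have "\<dots> = \<r> W \<cdot> (\<i>\<d> W \<star> e' V) \<cdot> (\<i>\<d> W \<star> (f \<star> \<i>\<d> (D V))) \<cdot> \<a> W Q (D V) \<cdot> (s \<star> \<i>\<d> (D V))
        \<cdot> inv_arrow C (\<a> W V (D V)) \<cdot> (\<i>\<d> W \<star> c V) \<cdot> inv_arrow C (\<r> W)"
    by (simp add: comp_reduce[OF t4] comp_reduce[OF t5] comp_reduce[OF t6])
  also have "\<dots> = partial_trace W V ((\<i>\<d> W \<star> f) \<cdot> s)"
    unfolding partial_trace_def by (simp add: whisker_right comp_reduce[OF t7])
  finally show ?thesis .
qed

text \<open>
  Tensored with a projective \<open>P\<close>, every \<open>V\<close> becomes a retract of a projective: take \<open>Q = (D P \<boxtimes> P) \<boxtimes> V\<close>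
  with the map to \<open>V\<close> given by the evaluation, which the coevaluation splits by the zigzag identity.
\<close>

lemma projective_split:
  assumes P: "projective_object C P" and V [simp]: "V \<in> Obj C"
  shows "\<exists>Q q s. projective_object C Q \<and> q \<in> Arr C Q V \<and> s \<in> Arr C (P \<boxtimes> V) (P \<boxtimes> Q) \<and>
    (\<i>\<d> P \<star> q) \<cdot> s = \<i>\<d> (P \<boxtimes> V)"
proof -
  have [simp]: "P \<in> Obj C" using P by (rule projective_obj)
  let ?q = "\<l> V \<cdot> (e P \<star> \<i>\<d> V)"
  let ?z = "\<a> P (D P) P \<cdot> (c P \<star> \<i>\<d> P) \<cdot> inv_arrow C (\<l> P)"
  let ?s = "\<a> P (D P \<boxtimes> P) V \<cdot> (?z \<star> \<i>\<d> V)"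
  have nat: "(\<i>\<d> P \<star> (e P \<star> \<i>\<d> V)) \<cdot> \<a> P (D P \<boxtimes> P) V = \<a> P \<I> V \<cdot> ((\<i>\<d> P \<star> e P) \<star> \<i>\<d> V)"
    using assoc_nat[of "\<i>\<d> P" "e P" "\<i>\<d> V"] by simp
  have "(\<i>\<d> P \<star> ?q) \<cdot> ?s = (\<i>\<d> P \<star> \<l> V) \<cdot> (\<i>\<d> P \<star> (e P \<star> \<i>\<d> V)) \<cdot> \<a> P (D P \<boxtimes> P) V \<cdot> (?z \<star> \<i>\<d> V)"
    by (simp add: whisker_left)
  also have "\<dots> = (\<r> P \<star> \<i>\<d> V) \<cdot> ((\<i>\<d> P \<star> e P) \<star> \<i>\<d> V) \<cdot> (?z \<star> \<i>\<d> V)"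
    by (simp add: comp_reduce[OF nat] comp_reduce[OF triangle])
  also have "\<dots> = (\<r> P \<cdot> (\<i>\<d> P \<star> e P) \<cdot> ?z) \<star> \<i>\<d> V"
    by (simp add: interchange)
  also have "\<dots> = \<i>\<d> (P \<boxtimes> V)"
    by (simp add: left_dualD(7)[OF left])
  finally have "(\<i>\<d> P \<star> ?q) \<cdot> ?s = \<i>\<d> (P \<boxtimes> V)" .
  moreover have "projective_object C ((D P \<boxtimes> P) \<boxtimes> V)"
    using P by (intro projective_ten_right projective_ten_left) auto
  ultimately show ?thesis
    by (intro exI[of _ "(D P \<boxtimes> P) \<boxtimes> V"] exI[of _ ?q] exI[of _ ?s]) simp
qed

text \<open>
  With \<open>q : Q \<rightarrow> V\<close> and \<open>s\<close> as above, \<open>f = (\<i>\<d> P \<star> q) \<cdot> s \<cdot> f\<close>. Cyclicity of \<open>t\<close> brings \<open>\<i>\<d> P \<star> q\<close> to the right end,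
  so that the trace is taken over the projective \<open>Q\<close>, and cyclicity of the partial trace brings it back.
\<close>

lemma partial_trace_property_extends:
  assumes cy: "calabi_yau_structure K (Proj C) t"
    and proj: "\<And>U V f. \<lbrakk>projective_object C U; projective_object C V; f \<in> Arr C (U \<boxtimes> V) (U \<boxtimes> V)\<rbrakk>
      \<Longrightarrow> t (U \<boxtimes> V) f = t U (partial_trace U V f)"
    and P: "projective_object C P" and V [simp]: "V \<in> Obj C" and "f \<in> Arr C (P \<boxtimes> V) (P \<boxtimes> V)"
  shows "t (P \<boxtimes> V) f = t P (partial_trace P V f)"
proof -
  have [simp]: "P \<in> Obj C" using P by (rule projective_obj)
  then have [simp]: "arr f" "src f = P \<boxtimes> V" "tgt f = P \<boxtimes> V" using assms(5) by auto
  obtain Q q s where Q: "projective_object C Q" and "q \<in> Arr C Q V" "s \<in> Arr C (P \<boxtimes> V) (P \<boxtimes> Q)"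
    and s: "(\<i>\<d> P \<star> q) \<cdot> s = \<i>\<d> (P \<boxtimes> V)"
    using projective_split[OF P V] by blast
  moreover have [simp]: "Q \<in> Obj C" using Q by (rule projective_obj)
  ultimately have [simp]: "arr q" "src q = Q" "tgt q = V" "arr s" "src s = P \<boxtimes> V" "tgt s = P \<boxtimes> Q" by auto
  have f: "(\<i>\<d> P \<star> q) \<cdot> s \<cdot> f = f" using comp_reduce[OF s, of f] by simp
  have "t (P \<boxtimes> V) f = t (P \<boxtimes> V) ((\<i>\<d> P \<star> q) \<cdot> (s \<cdot> f))" by (simp only: f)
  also have "\<dots> = t (P \<boxtimes> Q) ((s \<cdot> f) \<cdot> (\<i>\<d> P \<star> q))"
    using P Q by (intro calabi_yau_cyclic[OF cy] projective_ten_right) auto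
  also have "\<dots> = t P (partial_trace P Q ((s \<cdot> f) \<cdot> (\<i>\<d> P \<star> q)))"
    using P Q by (intro proj) auto
  also have "\<dots> = t P (partial_trace P V ((\<i>\<d> P \<star> q) \<cdot> (s \<cdot> f)))"
    by (subst partial_trace_cyclic) auto
  finally show ?thesis by (simp only: f)
qed

text \<open>
  A zigzag identity writes \<open>\<i>\<d> P\<close> as a composite through \<open>P \<boxtimes> (D P \<boxtimes> P)\<close>. Composing with \<open>f\<close> and moving
  \<open>f\<close> to that spot, it appears there as \<open>f \<star> \<i>\<d> (D P \<boxtimes> P)\<close>, hence vanishes if \<open>f \<star> \<i>\<d> (D P)\<close> does. If \<open>P\<close> is
  the source, the zigzag of the left duality is used, and that of the right duality if it is the target.
\<close>

lemma faithful_ten_dual: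
  assumes [simp]: "X \<in> Obj C" "Y \<in> Obj C" "arr f" "src f = X" "tgt f = Y"
    and f0: "f \<star> \<i>\<d> (D P) = null (X \<boxtimes> D P) (Y \<boxtimes> D P)" and [simp]: "P \<in> Obj C"
    and XY: "X = P \<or> Y = P"
  shows "f = null X Y"
proof -
  have "(f \<star> \<i>\<d> (D P \<boxtimes> P)) \<cdot> \<a> X (D P) P = \<a> Y (D P) P \<cdot> ((f \<star> \<i>\<d> (D P)) \<star> \<i>\<d> P)"
    using assoc_nat[of f "\<i>\<d> (D P)" "\<i>\<d> P"] by simp
  also have "\<dots> = null (X \<boxtimes> (D P \<boxtimes> P)) (Y \<boxtimes> (D P \<boxtimes> P)) \<cdot> \<a> X (D P) P" by (simp add: f0)
  finally have f0': "f \<star> \<i>\<d> (D P \<boxtimes> P) = null (X \<boxtimes> (D P \<boxtimes> P)) (Y \<boxtimes> (D P \<boxtimes> P))"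
    by (rule iso_cancel_right[rotated 5]) auto
  from XY show ?thesis
  proof
    assume [simp]: "X = P"
    have s1: "f \<cdot> \<r> P = \<r> Y \<cdot> (f \<star> \<i>\<d> \<I>)" using runit_nat[of f] by simp
    have s2: "(f \<star> \<i>\<d> \<I>) \<cdot> (\<i>\<d> P \<star> e P) = (\<i>\<d> Y \<star> e P) \<cdot> (f \<star> \<i>\<d> (D P \<boxtimes> P))"
      by (simp add: interchange)
    have "f = f \<cdot> \<r> P \<cdot> (\<i>\<d> P \<star> e P) \<cdot> \<a> P (D P) P \<cdot> (c P \<star> \<i>\<d> P) \<cdot> inv_arrow C (\<l> P)"
      by (simp add: left_dualD(7)[OF left])
    also have "\<dots> = null P Y"
      by (simp add: comp_reduce[OF s1] comp_reduce[OF s2] f0'[simplified])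
    finally show ?thesis by simp
  next
    assume [simp]: "Y = P"
    have s1: "inv_arrow C (\<r> P) \<cdot> f = (f \<star> \<i>\<d> \<I>) \<cdot> inv_arrow C (\<r> X)" using runit_inv_nat[of f] by simp
    have s2: "(\<i>\<d> P \<star> c' P) \<cdot> (f \<star> \<i>\<d> \<I>) = (f \<star> \<i>\<d> (D P \<boxtimes> P)) \<cdot> (\<i>\<d> X \<star> c' P)"
      by (simp add: interchange)
    have "f = (\<l> P \<cdot> (e' P \<star> \<i>\<d> P) \<cdot> inv_arrow C (\<a> P (D P) P) \<cdot> (\<i>\<d> P \<star> c' P) \<cdot> inv_arrow C (\<r> P)) \<cdot> f"
      by (subst left_dualD(8)[OF right]) auto
    also have "\<dots> = null X P"
      by (simp add: s1 comp_reduce[OF s2] f0'[simplified])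
    finally show ?thesis by simp
  qed
qed

text \<open>
  Non-degeneracy passes from projective \<open>M\<close> to all \<open>M\<close>. The projective \<open>Q = (M \<boxtimes> D P) \<boxtimes> P\<close> maps to \<open>M\<close>
  by the counit of one duality of \<open>P\<close>, and \<open>M\<close> maps to \<open>Q\<close> by the unit of the other. If \<open>a : M \<rightarrow> P\<close> pairs to zero
  with all \<open>P \<rightarrow> M\<close>, then its composite with the counit pairs to zero with all \<open>P \<rightarrow> Q\<close>, so it is zero.
  This composite corresponds to \<open>a \<star> \<i>\<d> (D P)\<close> under the adjunction, and therefore \<open>a = 0\<close>. The unit serves
  arrows \<open>P \<rightarrow> M\<close> in the same way.
\<close>

lemma calabi_yau_nondegenerate:
  assumes cy: "calabi_yau_structure K (Proj C) t"
  shows "nondegenerate_traces K C t"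
  unfolding nondegenerate_traces_def nondegenerate_pairing_def
proof (intro ballI conjI impI)
  fix P M assume "P \<in> Obj (Proj C)" and M [simp]: "M \<in> Obj C"
  then have P: "projective_object C P" and [simp]: "P \<in> Obj C" by (auto dest: projective_obj)
  let ?Q = "(M \<boxtimes> D P) \<boxtimes> P" and ?i = "\<i>\<d> (M \<boxtimes> D P)"
  have Q: "projective_object C ?Q" using P by (intro projective_ten_left) auto
  note dual = left[OF \<open>P \<in> Obj C\<close>] right[OF \<open>P \<in> Obj C\<close>]
  note nondeg = calabi_yau_pairing[OF cy Q P] calabi_yau_pairing[OF cy P Q]
  {
    fix a assume "a \<in> Arr C M P" and 0: "\<forall>b\<in>Arr C P M. t P (a \<cdot> b) = \<zero>\<^bsub>K\<^esub>"
    then have [simp]: "arr a" "src a = M" "tgt a = P" by auto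
    let ?q = "uncurry P (D P) (e P) M ?i"
    have [simp]: "arr ?q" "src ?q = ?Q" "tgt ?q = M" using arr_uncurry[OF dual(1), of M ?i] by auto
    have "t P ((a \<cdot> ?q) \<cdot> b) = \<zero>\<^bsub>K\<^esub>" if "b \<in> Arr C P ?Q" for b
      using 0 that by simp
    moreover have "a \<cdot> ?q \<in> Arr C ?Q P" by simp
    ultimately have "a \<cdot> ?q = null ?Q P"
      using nondeg(1) unfolding nondegenerate_pairing_def by auto
    moreover have "a \<cdot> ?q = uncurry P (D P) (e P) P (a \<star> \<i>\<d> (D P))"
      by (subst comp_uncurry[OF dual(1)]) auto
    ultimately have "curry P (D P) (c P) (M \<boxtimes> D P) (null ?Q P) = a \<star> \<i>\<d> (D P)"
      using curry_uncurry[OF dual(1), of P "a \<star> \<i>\<d> (D P)" "M \<boxtimes> D P"] by simp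
    then have "a \<star> \<i>\<d> (D P) = null (M \<boxtimes> D P) (P \<boxtimes> D P)"
      unfolding curry_def by simp
    then show "a = null M P" by (intro faithful_ten_dual[of M P a P]) auto
  next
    fix b assume "b \<in> Arr C P M" and 0: "\<forall>a\<in>Arr C M P. t P (a \<cdot> b) = \<zero>\<^bsub>K\<^esub>"
    then have [simp]: "arr b" "src b = P" "tgt b = M" by auto
    let ?j = "curry (D P) P (c' P) M ?i"
    have [simp]: "arr ?j" "src ?j = M" "tgt ?j = ?Q" using arr_curry[OF dual(2), of M ?i] by auto
    have "t P (a \<cdot> (?j \<cdot> b)) = \<zero>\<^bsub>K\<^esub>" if "a \<in> Arr C ?Q P" for a
      using 0[rule_format, of "a \<cdot> ?j"] that by simp
    moreover have "?j \<cdot> b \<in> Arr C P ?Q" by simp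
    ultimately have "?j \<cdot> b = null P ?Q"
      using nondeg(1) unfolding nondegenerate_pairing_def by auto
    moreover have "?j \<cdot> b = curry (D P) P (c' P) P (b \<star> \<i>\<d> (D P))"
      by (subst curry_comp[OF dual(2)]) auto
    ultimately have "uncurry (D P) P (e' P) (M \<boxtimes> D P) (null P ?Q) = b \<star> \<i>\<d> (D P)"
      using uncurry_curry[OF dual(2), of P "b \<star> \<i>\<d> (D P)" "M \<boxtimes> D P"] by simp
    then have "b \<star> \<i>\<d> (D P) = null (P \<boxtimes> D P) (M \<boxtimes> D P)"
      unfolding uncurry_def by simp
    then show "b = null P M" by (intro faithful_ten_dual[of P M b P]) auto
  }
qed

end


section \<open>Finite pivotal categories\<close>

context abelian_category
begin

lemma cokernel_epic:
  assumes "X \<in> Obj C" "Y \<in> Obj C" "Z \<in> Obj C" "is_cokernel C X Y f Z q"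
  shows "epic C Y Z q"
proof -
  have q [simp]: "arr f" "src f = X" "tgt f = Y" "arr q" "src q = Y" "tgt q = Z" "q \<cdot> f = null X Z"
    and ex1: "\<And>W h. W \<in> Obj C \<Longrightarrow> h \<in> Arr C Y W \<Longrightarrow> h \<cdot> f = null X W \<Longrightarrow> \<exists>!u. u \<in> Arr C Z W \<and> u \<cdot> q = h"
    using assms unfolding is_cokernel_def by auto
  have "g = h" if "W \<in> Obj C" "g \<in> Arr C Z W" "h \<in> Arr C Z W" "g \<cdot> q = h \<cdot> q" for W g h
  proof -
    have "g \<cdot> q \<in> Arr C Y W" "(g \<cdot> q) \<cdot> f = null X W" using that assms by auto
    from ex1[OF that(1) this] that show ?thesis by auto
  qed
  then show ?thesis unfolding epic_def using assms by simp
qed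

text \<open>
  An epimorphism is the cokernel of some \<open>g\<close>; as \<open>g\<close> factors through the kernel \<open>k\<close> of the epimorphism, it is
  the cokernel of \<open>k\<close> as well.
\<close>

lemma epic_short_exact:
  assumes [simp]: "X \<in> Obj C" "Y \<in> Obj C" and epi: "epic C X Y f"
  shows "\<exists>N\<in>Obj C. \<exists>k. short_exact C N X Y k f"
proof -
  have f [simp]: "arr f" "src f = X" "tgt f = Y" using epi unfolding epic_def by auto
  obtain W g where W [simp]: "W \<in> Obj C" and g: "is_cokernel C W X g Y f"
    using epic_normal[OF assms] by blast
  obtain N k where N [simp]: "N \<in> Obj C" and k: "is_kernel C X Y f N k"
    using has_kernels[of X Y f] by auto
  have [simp]: "arr g" "src g = W" "tgt g = X" "f \<cdot> g = null W Y" using g unfolding is_cokernel_def by auto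
  have [simp]: "arr k" "src k = N" "tgt k = X" "f \<cdot> k = null N Y" using k unfolding is_kernel_def by auto
  obtain u where u [simp]: "arr u" "src u = W" "tgt u = N" and gu: "k \<cdot> u = g"
    using k unfolding is_kernel_def by (metis Arr_iff W N \<open>arr g\<close> \<open>src g = W\<close> \<open>tgt g = X\<close> \<open>f \<cdot> g = null W Y\<close> assms(1))
  have uni: "\<exists>!v. v \<in> Arr C Y Z \<and> v \<cdot> f = h"
    if [simp]: "Z \<in> Obj C" and h: "h \<in> Arr C X Z" "h \<cdot> k = null N Z" for Z h
  proof -
    have "h \<cdot> g = (h \<cdot> k) \<cdot> u" using h(1) by (simp add: gu)
    then have "h \<cdot> g = null W Z" using h(2) by simp
    then show ?thesis using g h(1) that(1) unfolding is_cokernel_def by blast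
  qed
  have "is_cokernel C N X k Y f"
    unfolding is_cokernel_def by (intro conjI ballI impI uni) simp_all
  then show ?thesis using k N unfolding short_exact_def by blast
qed

end

context finite_pivotal_category
begin

declare dual_closed [simp]

lemma tensor_epic:
  assumes [simp]: "X \<in> Obj C" "Y \<in> Obj C" "V \<in> Obj C" and "epic C X Y f"
  shows "epic C (X \<boxtimes> V) (Y \<boxtimes> V) (f \<star> \<i>\<d> V)" "epic C (V \<boxtimes> X) (V \<boxtimes> Y) (\<i>\<d> V \<star> f)"
proof -
  obtain N k where [simp]: "N \<in> Obj C" and N: "short_exact C N X Y k f"
    using epic_short_exact[OF assms(1,2,4)] by blast
  show "epic C (X \<boxtimes> V) (Y \<boxtimes> V) (f \<star> \<i>\<d> V)"
    using ten_right_exact[OF _ _ _ _ N, of V] unfolding short_exact_def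
    by (intro cokernel_epic[of "N \<boxtimes> V" _ _ "k \<star> \<i>\<d> V"]) auto
  show "epic C (V \<boxtimes> X) (V \<boxtimes> Y) (\<i>\<d> V \<star> f)"
    using ten_left_exact[OF _ _ _ _ N, of V] unfolding short_exact_def
    by (intro cokernel_epic[of "V \<boxtimes> N" _ _ "\<i>\<d> V \<star> k"]) auto
qed

lemma left_duality_arr [simp]:
  assumes "X \<in> Obj C"
  shows "arr (ev X)" "src (ev X) = X\<^sup>\<or> \<boxtimes> X" "tgt (ev X) = \<I>"
    "arr (coev X)" "src (coev X) = \<I>" "tgt (coev X) = X \<boxtimes> X\<^sup>\<or>"
  using left_dualD(1-6)[OF left_dual[OF assms]] assms by auto

lemma piv_arr [simp]:
  assumes "X \<in> Obj C"
  shows "iso (\<delta> X)" "arr (\<delta> X)" "src (\<delta> X) = X" "tgt (\<delta> X) = X\<^sup>\<or>\<^sup>\<or>"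
  using piv_iso[OF assms] assms iso_inv(1) by (auto simp: iso_arr_iso)

text \<open>Transport the left dual \<open>X\<^sup>\<or>\<^sup>\<or>\<close> of \<open>X\<^sup>\<or>\<close> along \<open>\<delta>\<close>.\<close>

lemma right_dual_pivotal:
  assumes "X \<in> Obj C"
  shows "is_left_dual C (X\<^sup>\<or>) X (ev_right C X) (coev_right C X)"
  unfolding ev_right_def coev_right_def
  using assms left_dual[of "X\<^sup>\<or>"] by (intro left_dual_along_iso) auto

text \<open>
  Up to \<open>\<l>\<close>, \<open>mate\<close> is \<open>curry\<close> and the last equation is \<open>uncurry_curry\<close> with target \<open>\<I>\<close>. The left
  unitor in \<open>mate\<close> matches the right unitor in \<open>uncurry\<close> by Kelly's law and \<open>\<l> \<I> = \<r> \<I>\<close>.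
\<close>

lemma mate_properties:
  assumes [simp]: "X \<in> Obj C" "Y \<in> Obj C" "arr f" "src f = Y \<boxtimes> X" "tgt f = \<I>"
  shows "arr (mate C Y X f)" "src (mate C Y X f) = Y" "tgt (mate C Y X f) = X\<^sup>\<or>"
    and "ev X \<cdot> (mate C Y X f \<star> \<i>\<d> X) = f"
proof -
  note dual = left_dual[OF assms(1)]
  let ?g = "curry X (X\<^sup>\<or>) (coev X) Y f"
  have [simp]: "arr ?g" "src ?g = Y" "tgt ?g = \<I> \<boxtimes> X\<^sup>\<or>"
    using arr_curry[OF dual, of Y f] by auto
  have m: "mate C Y X f = \<l> (X\<^sup>\<or>) \<cdot> ?g" unfolding mate_def curry_def by simp
  then show "arr (mate C Y X f)" "src (mate C Y X f) = Y" "tgt (mate C Y X f) = X\<^sup>\<or>" by auto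
  have s1: "ev X \<cdot> \<l> (X\<^sup>\<or> \<boxtimes> X) = \<l> \<I> \<cdot> (\<i>\<d> \<I> \<star> ev X)"
    using lunit_nat[of "ev X"] by simp
  have "ev X \<cdot> (mate C Y X f \<star> \<i>\<d> X) = ev X \<cdot> (\<l> (X\<^sup>\<or> \<boxtimes> X) \<cdot> \<a> \<I> (X\<^sup>\<or>) X) \<cdot> (?g \<star> \<i>\<d> X)"
    by (simp add: m whisker_right lunit_ten)
  also have "\<dots> = uncurry X (X\<^sup>\<or>) (ev X) \<I> ?g"
    unfolding uncurry_def by (simp add: comp_reduce[OF s1] flip: unitors_unit)
  also have "\<dots> = f" by (rule uncurry_curry[OF dual]) auto
  finally show "ev X \<cdot> (mate C Y X f \<star> \<i>\<d> X) = f" .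
qed

lemma dual_arrow_adjoint:
  assumes [simp]: "X \<in> Obj C" "Y \<in> Obj C" "arr f" "src f = X" "tgt f = Y"
  defines "p \<equiv> dual_arrow C X Y f"
  shows "arr p" "src p = Y\<^sup>\<or>" "tgt p = X\<^sup>\<or>"
    and "ev X \<cdot> (p \<star> \<i>\<d> X) = ev Y \<cdot> (\<i>\<d> (Y\<^sup>\<or>) \<star> f)"
    and "(f \<star> \<i>\<d> (X\<^sup>\<or>)) \<cdot> coev X = (\<i>\<d> Y \<star> p) \<cdot> coev Y"
proof -
  show p [simp]: "arr p" "src p = Y\<^sup>\<or>" "tgt p = X\<^sup>\<or>"
    and "ev X \<cdot> (p \<star> \<i>\<d> X) = ev Y \<cdot> (\<i>\<d> (Y\<^sup>\<or>) \<star> f)"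
    unfolding p_def dual_arrow_def using mate_properties[of X "Y\<^sup>\<or>" "ev Y \<cdot> (\<i>\<d> (Y\<^sup>\<or>) \<star> f)"] by auto
  then show "(f \<star> \<i>\<d> (X\<^sup>\<or>)) \<cdot> coev X = (\<i>\<d> Y \<star> p) \<cdot> coev Y"
    by (intro dual_map_coevaluation[OF left_dual left_dual]) auto
qed

text \<open>
  The adjoint of \<open>f\<close> is \<open>p = f\<^sup>\<or>\<close>. For the left duality this is the preceding lemma. Applied to \<open>p\<close>, that lemma
  relates \<open>p\<close> and \<open>f\<^sup>\<or>\<^sup>\<or>\<close>, and naturality of \<open>\<delta>\<close> replaces \<open>f\<^sup>\<or>\<^sup>\<or>\<close> by \<open>f\<close> in the right duality maps.
\<close>

sublocale two_sided_duals K C "Dual C" "Ev C" "Coev C" "ev_right C" "coev_right C"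
proof unfold_locales
  fix X Y f assume X [simp]: "X \<in> Obj C" and Y [simp]: "Y \<in> Obj C" and "f \<in> Arr C X Y"
  then have f [simp]: "arr f" "src f = X" "tgt f = Y" by auto
  define p where "p = dual_arrow C X Y f"
  note p [simp] = dual_arrow_adjoint(1-3)[OF X Y f, folded p_def]
  define q where "q = dual_arrow C (Y\<^sup>\<or>) (X\<^sup>\<or>) p"
  note q [simp] = dual_arrow_adjoint(1-3)[OF _ _ p, folded q_def, simplified]
  have nat: "q \<cdot> \<delta> X = \<delta> Y \<cdot> f" using piv_natural[of X Y f] unfolding q_def p_def by simp
  have nat': "inv_arrow C (\<delta> Y) \<cdot> q = f \<cdot> inv_arrow C (\<delta> X)"
  proof (rule iso_cancel_right[of "\<delta> X"])
    show "(inv_arrow C (\<delta> Y) \<cdot> q) \<cdot> \<delta> X = (f \<cdot> inv_arrow C (\<delta> X)) \<cdot> \<delta> X"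
      by (simp add: nat)
  qed auto
  have s1: "(\<delta> X \<star> \<i>\<d> (X\<^sup>\<or>)) \<cdot> (\<i>\<d> X \<star> p) = (\<i>\<d> (X\<^sup>\<or>\<^sup>\<or>) \<star> p) \<cdot> (\<delta> X \<star> \<i>\<d> (Y\<^sup>\<or>))"
    by (simp add: interchange)
  have s2: "ev (X\<^sup>\<or>) \<cdot> (\<i>\<d> (X\<^sup>\<or>\<^sup>\<or>) \<star> p) = ev (Y\<^sup>\<or>) \<cdot> (q \<star> \<i>\<d> (Y\<^sup>\<or>))"
    using dual_arrow_adjoint(4)[OF _ _ p, folded q_def] by simp
  have "ev_right C X \<cdot> (\<i>\<d> X \<star> p) = ev (Y\<^sup>\<or>) \<cdot> (q \<star> \<i>\<d> (Y\<^sup>\<or>)) \<cdot> (\<delta> X \<star> \<i>\<d> (Y\<^sup>\<or>))"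
    unfolding ev_right_def by (simp add: s1 comp_reduce[OF s2])
  also have "\<dots> = ev_right C Y \<cdot> (f \<star> \<i>\<d> (Y\<^sup>\<or>))"
    unfolding ev_right_def by (simp add: interchange nat)
  finally have 1: "ev_right C X \<cdot> (\<i>\<d> X \<star> p) = ev_right C Y \<cdot> (f \<star> \<i>\<d> (Y\<^sup>\<or>))" .
  have s3: "(\<i>\<d> (X\<^sup>\<or>) \<star> f) \<cdot> (\<i>\<d> (X\<^sup>\<or>) \<star> inv_arrow C (\<delta> X)) = (\<i>\<d> (X\<^sup>\<or>) \<star> inv_arrow C (\<delta> Y)) \<cdot> (\<i>\<d> (X\<^sup>\<or>) \<star> q)"
    by (simp add: nat' flip: whisker_left)
  have s4: "(\<i>\<d> (X\<^sup>\<or>) \<star> q) \<cdot> coev (X\<^sup>\<or>) = (p \<star> \<i>\<d> (Y\<^sup>\<or>\<^sup>\<or>)) \<cdot> coev (Y\<^sup>\<or>)"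
    using dual_arrow_adjoint(5)[OF _ _ p, folded q_def] by simp
  have s5: "(\<i>\<d> (X\<^sup>\<or>) \<star> inv_arrow C (\<delta> Y)) \<cdot> (p \<star> \<i>\<d> (Y\<^sup>\<or>\<^sup>\<or>)) = (p \<star> \<i>\<d> Y) \<cdot> (\<i>\<d> (Y\<^sup>\<or>) \<star> inv_arrow C (\<delta> Y))"
    by (simp add: interchange)
  have "(\<i>\<d> (X\<^sup>\<or>) \<star> f) \<cdot> coev_right C X = (p \<star> \<i>\<d> Y) \<cdot> coev_right C Y"
    unfolding coev_right_def by (simp add: comp_reduce[OF s3] s4 comp_reduce[OF s5])
  with 1 show "\<exists>p\<in>Arr C (Y\<^sup>\<or>) (X\<^sup>\<or>).
        (f \<star> \<i>\<d> (X\<^sup>\<or>)) \<cdot> coev X = (\<i>\<d> Y \<star> p) \<cdot> coev Y \<and>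
        ev_right C X \<cdot> (\<i>\<d> X \<star> p) = ev_right C Y \<cdot> (f \<star> \<i>\<d> (Y\<^sup>\<or>)) \<and>
        (\<i>\<d> (X\<^sup>\<or>) \<star> f) \<cdot> coev_right C X = (p \<star> \<i>\<d> Y) \<cdot> coev_right C Y \<and>
        ev X \<cdot> (p \<star> \<i>\<d> X) = ev Y \<cdot> (\<i>\<d> (Y\<^sup>\<or>) \<star> f)"
    using dual_arrow_adjoint(4,5)[OF X Y f, folded p_def] by (intro bexI[of _ p]) auto
qed (use left_dual right_dual_pivotal tensor_epic in auto)

lemma tr_right_partial_trace: "tr_right C W V f = partial_trace W V f"
  unfolding tr_right_def partial_trace_def ..

lemma tr_left_partial_trace:
  assumes "W \<in> Obj C" "V \<in> Obj C"
  shows "tr_left C V W f = two_sided_duals.partial_trace (reversed C) (Dual C) (coev_right C) (Ev C) W V f"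
  using assms
  by (simp add: tr_left_def two_sided_duals.partial_trace_def[OF two_sided_duals_reversed])

lemma tr_right_comp:
  assumes [simp]: "U \<in> Obj C" "V \<in> Obj C" "arr a" "src a = U \<boxtimes> V" "arr b" "src b = tgt a" "tgt b = U \<boxtimes> V"
  shows "tr_right C U V (b \<cdot> a) = d_cap_right C U V b \<cdot> d_cup_right C U V a"
  unfolding tr_right_def d_cap_right_def d_cup_right_def by (simp add: whisker_right)

lemma tr_left_comp:
  assumes [simp]: "U \<in> Obj C" "V \<in> Obj C" "arr a" "src a = U \<boxtimes> V" "arr b" "src b = tgt a" "tgt b = U \<boxtimes> V"
  shows "tr_left C U V (b \<cdot> a) = d_cap_left C U V b \<cdot> d_cup_left C U V a"
  unfolding tr_left_def d_cap_left_def d_cup_left_def by (simp add: whisker_left)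

text \<open>
  Compatibility is the partial trace property for projective \<open>V\<close>, stated for factored endomorphisms: for
  \<open>f : U \<boxtimes> V \<rightarrow> U \<boxtimes> V\<close>, take \<open>W = U \<boxtimes> V\<close>, which is projective, \<open>a = f\<close> and \<open>b = \<i>\<d>\<close>.
\<close>

lemma compatible_right_iff_partial_trace:
  assumes cy: "calabi_yau_structure K (Proj C) t"
  shows "compatible_right C t \<longleftrightarrow> right_partial_trace C t"
proof
  assume comp: "compatible_right C t"
  have proj: "t (U \<boxtimes> V) f = t U (tr_right C U V f)"
    if "projective_object C U" "projective_object C V" "f \<in> Arr C (U \<boxtimes> V) (U \<boxtimes> V)" for U V f
  proof -
    note [simp] = that(1,2)[THEN projective_obj]
    have "projective_object C (U \<boxtimes> V)" using that by (simp add: projective_ten_right)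
    then have "t (U \<boxtimes> V) (\<i>\<d> (U \<boxtimes> V) \<cdot> f)
        = t U (d_cap_right C U V (\<i>\<d> (U \<boxtimes> V)) \<cdot> d_cup_right C U V f)"
      using that by (intro comp[unfolded compatible_right_def, rule_format]) auto
    then show ?thesis using that tr_right_comp[of U V f "\<i>\<d> (U \<boxtimes> V)"] by simp
  qed
  then show "right_partial_trace C t"
    unfolding right_partial_trace_def tr_right_partial_trace
  proof (intro ballI)
    fix P V f assume P: "P \<in> Obj (Proj C)" and V: "V \<in> Obj C" and f: "f \<in> Arr C (P \<boxtimes> V) (P \<boxtimes> V)"
    show "t (P \<boxtimes> V) f = t P (partial_trace P V f)"
      by (rule partial_trace_property_extends[OF cy _ P[unfolded Proj_simps mem_Collect_eq] V f])
        (rule proj[unfolded tr_right_partial_trace])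
  qed
next
  assume pt: "right_partial_trace C t"
  show "compatible_right C t"
    unfolding compatible_right_def
  proof (intro ballI)
    fix U V W a b
    assume U: "U \<in> Obj (Proj C)" and V: "V \<in> Obj (Proj C)" and W: "W \<in> Obj (Proj C)"
      and a: "a \<in> Arr C (U \<boxtimes> V) W" and b: "b \<in> Arr C W (U \<boxtimes> V)"
    have [simp]: "U \<in> Obj C" "V \<in> Obj C" "W \<in> Obj C" using U V W by (auto dest: projective_obj)
    have "t (U \<boxtimes> V) (b \<cdot> a) = t U (tr_right C U V (b \<cdot> a))"
      using pt[unfolded right_partial_trace_def, rule_format, OF U, of V "b \<cdot> a"] a b by simp
    then show "t (U \<boxtimes> V) (b \<cdot> a) = t U (d_cap_right C U V b \<cdot> d_cup_right C U V a)"
      using tr_right_comp[of U V a b] a b by simp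
  qed
qed

lemma compatible_left_iff_partial_trace:
  assumes cy: "calabi_yau_structure K (Proj C) t"
  shows "compatible_left C t \<longleftrightarrow> left_partial_trace C t"
proof
  assume comp: "compatible_left C t"
  have proj: "t (U \<boxtimes> V) f = t V (tr_left C U V f)"
    if "projective_object C U" "projective_object C V" "f \<in> Arr C (U \<boxtimes> V) (U \<boxtimes> V)" for U V f
  proof -
    note [simp] = that(1,2)[THEN projective_obj]
    have "projective_object C (U \<boxtimes> V)" using that by (simp add: projective_ten_right)
    then have "t (U \<boxtimes> V) (\<i>\<d> (U \<boxtimes> V) \<cdot> f)
        = t V (d_cap_left C U V (\<i>\<d> (U \<boxtimes> V)) \<cdot> d_cup_left C U V f)"
      using that by (intro comp[unfolded compatible_left_def, rule_format]) auto
    then show ?thesis using that tr_left_comp[of U V f "\<i>\<d> (U \<boxtimes> V)"] by simp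
  qed
  show "left_partial_trace C t"
    unfolding left_partial_trace_def
  proof (intro ballI)
    fix P V f assume P: "P \<in> Obj (Proj C)" and V: "V \<in> Obj C" and f: "f \<in> Arr C (V \<boxtimes> P) (V \<boxtimes> P)"
    have "t (P \<boxtimes>\<^bsub>reversed C\<^esub> V) f =
        t P (two_sided_duals.partial_trace (reversed C) (Dual C) (coev_right C) (Ev C) P V f)"
    proof (rule two_sided_duals.partial_trace_property_extends[OF two_sided_duals_reversed])
      fix U W g
      assume "projective_object (reversed C) U" "projective_object (reversed C) W"
        "g \<in> Arr (reversed C) (U \<boxtimes>\<^bsub>reversed C\<^esub> W) (U \<boxtimes>\<^bsub>reversed C\<^esub> W)"
      then show "t (U \<boxtimes>\<^bsub>reversed C\<^esub> W) g =
          t U (two_sided_duals.partial_trace (reversed C) (Dual C) (coev_right C) (Ev C) U W g)"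
        using proj[of W U g] by (simp add: projective_obj flip: tr_left_partial_trace)
    qed (use cy P V f in auto)
    then show "t (V \<boxtimes> P) f = t P (tr_left C V P f)"
      using P V by (simp add: projective_obj tr_left_partial_trace)
  qed
next
  assume pt: "left_partial_trace C t"
  show "compatible_left C t"
    unfolding compatible_left_def
  proof (intro ballI)
    fix U V W a b
    assume U: "U \<in> Obj (Proj C)" and V: "V \<in> Obj (Proj C)" and W: "W \<in> Obj (Proj C)"
      and a: "a \<in> Arr C (U \<boxtimes> V) W" and b: "b \<in> Arr C W (U \<boxtimes> V)"
    have [simp]: "U \<in> Obj C" "V \<in> Obj C" "W \<in> Obj C" using U V W by (auto dest: projective_obj)
    have "t (U \<boxtimes> V) (b \<cdot> a) = t V (tr_left C U V (b \<cdot> a))"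
      using pt[unfolded left_partial_trace_def, rule_format, OF V, of U "b \<cdot> a"] a b by simp
    then show "t (U \<boxtimes> V) (b \<cdot> a) = t V (d_cap_left C U V b \<cdot> d_cup_left C U V a)"
      using tr_left_comp[of U V a b] a b by simp
  qed
qed

end

theorem theorem3p3:
  fixes K :: "('k, 'r) ring_scheme"
    and C :: "('k, 'o, 'm, 'z) pivotal_cat_scheme"
    and t :: "'o \<Rightarrow> 'm \<Rightarrow> 'k"
  assumes "finite_pivotal_category K C"
    and "calabi_yau_structure K (Proj C) t"
  shows "(compatible_right C t \<longleftrightarrow>
            nondegenerate_traces K C t \<and> right_partial_trace C t) \<and>
         (compatible_left C t \<longleftrightarrow>
            nondegenerate_traces K C t \<and> left_partial_trace C t)"
proof -
  interpret finite_pivotal_category K C by fact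
  show ?thesis
    using calabi_yau_nondegenerate compatible_right_iff_partial_trace
      compatible_left_iff_partial_trace assms(2)
    by blast
qed

end
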